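(* Let $d,m$ be positive integers, let $f:\mathbb{R}^d\to\mathbb{R}^d$ and $g_k:\mathbb{R}^d\to\mathbb{R}^d$, $k\in\{1,\dots,m\}$, be continuously differentiable, and let $\kappa=(\kappa_1,\dots,\kappa_m):\mathbb{R}^d\to\mathbb{R}^m$ be a feedback such that: (1) the nominal closed-loop system $\dot x(t)=f(x(t))+\sum_{k=1}^m g_k(x(t))\kappa_k(x(t))$ has a hyperbolic and locally asymptotically stable equilibrium at $0\in\mathbb{R}^d$; (2) the map $\xi\mapsto f(\xi)+\sum_{k=1}^m g_k(\xi)\kappa_k(\xi)$ is twice continuously differentiable in a neighborhood of $0$; (3) $f(0)=0$ and $\kappa_k(0)=0$ for each $k\in\{1,\dots,m\}$. Fix $T>0$. For $t_0\ge 0$ and a switching-time function $\tau(\cdot)$ (as defined in the context) consider the scheduled system $$\dot z(t)=f(z(t))+m\,g_{\hat\sigma(t-t_0;\tau)}(z(t))\,\kappa_{\hat\sigma(t-t_0;\tau)}(z(t)),\qquad z(t_0)=\bar x,\quad t\ge t_0,$$ where $$\hat\sigma(s;\tau)=1+\left\lfloor \frac{s-m\tau(s)\lfloor s/(m\tau(s))\rfloor}{\tau(s)}\right\rfloor\in\{1,\dots,m\},\qquad s\ge 0.$$ Then the equilibrium $0\in\mathbb{R}^d$ of this scheduled system is locally uniformly asymptotically stable, considering the switching time as a parameter. Moreover, for every $\varepsilon>0$ there exists a pair $(\delta,\tau'(\cdot))$, independent of $t_0$, where $\delta>0$ and $\tau'(\cdot)$ is a switching-time function, such that for every switching-time function $\tau$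 that dominates $\tau'$, with the switching scheme $\hat\sigma(\cdot;\tau)$: (i) $\|\bar x\|\le\delta\implies\|z(t)\|\le\varepsilon$ for all $t\ge t_0$; and (ii) for every $\eta>0$ there exists $\tilde T>0$, independent of $t_0$, such that (with the same switching scheme $\hat\sigma(\cdot;\tau)$) $\|\bar x\|\le\delta\implies\|z(t)\|\le\eta$ for all $t\ge t_0+\tilde T$.
   Context: $\|\cdot\|$ is the Euclidean norm. An equilibrium point of a system with continuously differentiable vector field is hyperbolic if the Jacobian of the vector field at that point has no eigenvalue on the imaginary axis. Switching-time function: with $T>0$ fixed, a piecewise constant non-increasing function $\tau:[0,+\infty[\,\to\,]0,+\infty[$ with $\tau(s)\to 0$ as $s\to+\infty$, which is constant on each interval $[(n-1)T,nT[$, $n\in\{1,2,\dots\}$; here $s=t-t_0$ is the time elapsed since $t_0$, so the switching time is held constant for $t\in[t_0+(n-1)T,\,t_0+nT[$. A switching-time function $\tau$ dominates another one $\tau'$ if $\tau(s)\le\tau'(s)$ for each $s$. Uniform asymptotic stability with the switching time as a parameter: the equilibrium $0$ is uniformly asymptotically stable if for every $\varepsilon>0$ there is a pair $(\delta,\tau(\cdot))$, with $\delta>0$ and $\tau(\cdot)$ a switching-time function, both dependent only on $\varepsilon$ and independent of $t_0$, such that for the scheduled system with this $\tau(\cdot)$, $\|\bar x\|\le\delta$ implies $\|z(t)\|\le\varepsilon$ for all $t\ge t_0$, and moreover for each $\eta>0$ there exists $\tilde T>0$ independent of $t_0$ such that, with the same $\tau(\cdot)$, $\|\bar x\|\le\delta$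 implies $\|z(t)\|\le\eta$ for all $t\ge t_0+\tilde T$. Standing assumptions: for all systems considered (the nominal closed-loop system and the scheduled systems) the right-hand side is measurable in $t$ and locally Lipschitz in the state, and (Carathéodory) solutions are unique and exist for all $t\ge t_0$. *)

theory Defs
  imports "HOL-Analysis.Analysis"
begin

definition C1_on :: "('a::euclidean_space \<Rightarrow> 'b::real_normed_vector) \<Rightarrow> 'a set \<Rightarrow> bool" where
  "C1_on f U \<longleftrightarrow> (\<exists>f' :: 'a \<Rightarrow> 'a \<Rightarrow>\<^sub>L 'b.
     (\<forall>x\<in>U. (f has_derivative blinfun_apply (f' x)) (at x)) \<and> continuous_on U f')"

definition C2_on :: "('a::euclidean_space \<Rightarrow> 'b::real_normed_vector) \<Rightarrow> 'a set \<Rightarrow> bool" where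
  "C2_on f U \<longleftrightarrow> (\<exists>f' :: 'a \<Rightarrow> 'a \<Rightarrow>\<^sub>L 'b.
     (\<forall>x\<in>U. (f has_derivative blinfun_apply (f' x)) (at x)) \<and> C1_on f' U)"

(* Absolute continuity of a function of a real variable on an interval; the library's
   absolutely_continuous is about measures. *)
definition abs_continuous_on :: "real set \<Rightarrow> (real \<Rightarrow> 'a::real_normed_vector) \<Rightarrow> bool" where
  "abs_continuous_on S z \<longleftrightarrow> (\<forall>\<epsilon>>0. \<exists>\<delta>>0. \<forall>(n::nat) a b.
     (\<forall>i<n. a i \<le> b i \<and> {a i..b i} \<subseteq> S) \<and>
     disjoint_family_on (\<lambda>i. {a i<..<b i}) {..<n} \<and> (\<Sum>i<n. b i - a i) < \<delta> \<longrightarrow>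
     (\<Sum>i<n. norm (z (b i) - z (a i))) < \<epsilon>)"

(* A Caratheodory solution of z' = F t z, z t0 = x0 on [t0, +oo). The values of z to the left
   of t0 are irrelevant. *)
definition caratheodory_solution ::
  "(real \<Rightarrow> 'a \<Rightarrow> 'a::euclidean_space) \<Rightarrow> real \<Rightarrow> 'a \<Rightarrow> (real \<Rightarrow> 'a) \<Rightarrow> bool" where
  "caratheodory_solution F t0 x0 z \<longleftrightarrow>
     z t0 = x0 \<and>
     (\<forall>c\<ge>t0. abs_continuous_on {t0..c} z) \<and>
     (AE t in lebesgue. t \<ge> t0 \<longrightarrow> (z has_vector_derivative F t (z t)) (at t within {t0..}))"

(* The standing assumptions on a system z' = F t z considered for t \<ge> t0. *)
definition well_posed :: "(real \<Rightarrow> 'a \<Rightarrow> 'a::euclidean_space) \<Rightarrow> real \<Rightarrow> bool" where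
  "well_posed F t0 \<longleftrightarrow>
     (\<forall>x. (\<lambda>t. F t x) \<in> borel_measurable (lebesgue_on {t0..})) \<and>
     local_lipschitz {t0..} UNIV F \<and>
     (\<forall>x0. \<exists>z. caratheodory_solution F t0 x0 z) \<and>
     (\<forall>x0 z w. caratheodory_solution F t0 x0 z \<and> caratheodory_solution F t0 x0 w \<longrightarrow>
        (\<forall>t\<ge>t0. z t = w t))"

definition hyperbolic_equilibrium :: "(real^'d \<Rightarrow> real^'d) \<Rightarrow> real^'d \<Rightarrow> bool" where
  "hyperbolic_equilibrium F p \<longleftrightarrow>
     F p = 0 \<and> F differentiable (at p) \<and>
     \<not> (\<exists>(lam::complex) (v::complex^'d). Re lam = 0 \<and> v \<noteq> 0 \<and>
          map_matrix complex_of_real (jacobian F (at p)) *v v = lam *s v)"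

(* Time-invariant system x' = F x, so the initial time is taken to be 0. *)
definition locally_asymptotically_stable :: "('a \<Rightarrow> 'a::euclidean_space) \<Rightarrow> bool" where
  "locally_asymptotically_stable F \<longleftrightarrow>
     F 0 = 0 \<and>
     (\<forall>\<epsilon>>0. \<exists>\<delta>>0. \<forall>x0 x. norm x0 \<le> \<delta> \<and> caratheodory_solution (\<lambda>_. F) 0 x0 x \<longrightarrow>
        (\<forall>t\<ge>0. norm (x t) \<le> \<epsilon>)) \<and>
     (\<exists>r>0. \<forall>x0 x. norm x0 \<le> r \<and> caratheodory_solution (\<lambda>_. F) 0 x0 x \<longrightarrow>
        (x \<longlongrightarrow> 0) at_top)"

(* Only the values on [0, +oo) matter. *)
definition switching_time :: "real \<Rightarrow> (real \<Rightarrow> real) \<Rightarrow> bool" where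
  "switching_time T \<tau> \<longleftrightarrow>
     (\<forall>s\<ge>0. \<tau> s > 0) \<and>
     antimono_on {0..} \<tau> \<and>
     (\<tau> \<longlongrightarrow> 0) at_top \<and>
     (\<forall>n::nat. n \<ge> 1 \<longrightarrow> \<tau> constant_on {(real n - 1) * T..<real n * T})"

(* The dominating function is the pointwise smaller one. *)
definition dominates :: "(real \<Rightarrow> real) \<Rightarrow> (real \<Rightarrow> real) \<Rightarrow> bool" where
  "dominates \<tau> \<tau>' \<longleftrightarrow> (\<forall>s\<ge>0. \<tau> s \<le> \<tau>' s)"

definition switch_index :: "nat \<Rightarrow> (real \<Rightarrow> real) \<Rightarrow> real \<Rightarrow> nat" where
  "switch_index m \<tau> s =
     1 + nat \<lfloor>(s - real m * \<tau> s * of_int \<lfloor>s / (real m * \<tau> s)\<rfloor>) / \<tau> s\<rfloor>"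

(* The conversion to nat in switch_index never truncates. *)
lemma switch_index_int:
  assumes "m \<ge> 1" "\<tau> s > 0"
  shows "int (switch_index m \<tau> s) =
           1 + \<lfloor>(s - real m * \<tau> s * of_int \<lfloor>s / (real m * \<tau> s)\<rfloor>) / \<tau> s\<rfloor>"
    and "switch_index m \<tau> s \<in> {1..m}"
proof -
  define p where "p = real m * \<tau> s"
  define r where "r = (s - p * of_int \<lfloor>s / p\<rfloor>) / \<tau> s"
  have p: "p > 0" using assms by (simp add: p_def)
  have "of_int \<lfloor>s / p\<rfloor> * p \<le> s"
    using of_int_floor_le[of "s / p"] unfolding pos_le_divide_eq[OF p] .
  moreover have "s < (of_int \<lfloor>s / p\<rfloor> + 1) * p"
    using floor_correct[of "s / p"] unfolding pos_divide_less_eq[OF p] by simp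
  ultimately have "p * of_int \<lfloor>s / p\<rfloor> \<le> s" "s < p * of_int \<lfloor>s / p\<rfloor> + p"
    by (simp_all add: algebra_simps)
  then have "0 \<le> s - p * of_int \<lfloor>s / p\<rfloor>" "s - p * of_int \<lfloor>s / p\<rfloor> < real m * \<tau> s"
    by (auto simp: p_def)
  then have "0 \<le> r" "r < real m"
    using assms(2) by (simp_all add: r_def pos_divide_less_eq)
  then have f: "0 \<le> \<lfloor>r\<rfloor>" "\<lfloor>r\<rfloor> < int m"
    by (auto simp: floor_less_iff)
  have e: "switch_index m \<tau> s = 1 + nat \<lfloor>r\<rfloor>"
    by (simp add: switch_index_def r_def p_def)
  show "int (switch_index m \<tau> s) =
           1 + \<lfloor>(s - real m * \<tau> s * of_int \<lfloor>s / (real m * \<tau> s)\<rfloor>) / \<tau> s\<rfloor>"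
    using f(1) unfolding e by (simp add: r_def p_def)
  show "switch_index m \<tau> s \<in> {1..m}"
    unfolding e atLeastAtMost_iff using f by linarith
qed

definition nominal_field ::
  "nat \<Rightarrow> ('a \<Rightarrow> 'a) \<Rightarrow> (nat \<Rightarrow> 'a \<Rightarrow> 'a::real_vector) \<Rightarrow> (nat \<Rightarrow> 'a \<Rightarrow> real) \<Rightarrow> 'a \<Rightarrow> 'a" where
  "nominal_field m f g \<kappa> x = f x + (\<Sum>k=1..m. \<kappa> k x *\<^sub>R g k x)"

definition scheduled_field ::
  "nat \<Rightarrow> ('a \<Rightarrow> 'a) \<Rightarrow> (nat \<Rightarrow> 'a \<Rightarrow> 'a::real_vector) \<Rightarrow> (nat \<Rightarrow> 'a \<Rightarrow> real) \<Rightarrow>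
   (real \<Rightarrow> real) \<Rightarrow> real \<Rightarrow> real \<Rightarrow> 'a \<Rightarrow> 'a" where
  "scheduled_field m f g \<kappa> \<tau> t0 t z =
     (let k = switch_index m \<tau> (t - t0) in f z + real m *\<^sub>R (\<kappa> k z *\<^sub>R g k z))"

(* The two requirements in the definition of uniform asymptotic stability, for one fixed pair
   (\<delta>, \<tau>) and radius \<epsilon>. G \<tau> t0 is the right-hand side of the system switched by \<tau> and started
   at t0. All bounds are uniform in t0 \<ge> 0. *)
definition uniformly_confined ::
  "((real \<Rightarrow> real) \<Rightarrow> real \<Rightarrow> real \<Rightarrow> 'a \<Rightarrow> 'a::euclidean_space) \<Rightarrow> real \<Rightarrow> (real \<Rightarrow> real) \<Rightarrow> real \<Rightarrow> bool" where
  "uniformly_confined G \<delta> \<tau> \<epsilon> \<longleftrightarrow>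
     (\<forall>t0\<ge>0. \<forall>x0 z. caratheodory_solution (G \<tau> t0) t0 x0 z \<longrightarrow>
        norm x0 \<le> \<delta> \<longrightarrow> (\<forall>t\<ge>t0. norm (z t) \<le> \<epsilon>))"

definition uniformly_attracted ::
  "((real \<Rightarrow> real) \<Rightarrow> real \<Rightarrow> real \<Rightarrow> 'a \<Rightarrow> 'a::euclidean_space) \<Rightarrow> real \<Rightarrow> (real \<Rightarrow> real) \<Rightarrow> bool" where
  "uniformly_attracted G \<delta> \<tau> \<longleftrightarrow>
     (\<forall>\<eta>>0. \<exists>T'>0. \<forall>t0\<ge>0. \<forall>x0 z. caratheodory_solution (G \<tau> t0) t0 x0 z \<longrightarrow>
        norm x0 \<le> \<delta> \<longrightarrow> (\<forall>t\<ge>t0 + T'. norm (z t) \<le> \<eta>))"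

(* Local uniform asymptotic stability of 0, with the switching time as a parameter. *)
definition uniformly_asymptotically_stable ::
  "real \<Rightarrow> ((real \<Rightarrow> real) \<Rightarrow> real \<Rightarrow> real \<Rightarrow> 'a \<Rightarrow> 'a::euclidean_space) \<Rightarrow> bool" where
  "uniformly_asymptotically_stable T G \<longleftrightarrow>
     (\<forall>\<tau> t0 t. switching_time T \<tau> \<longrightarrow> 0 \<le> t0 \<longrightarrow> t0 \<le> t \<longrightarrow> G \<tau> t0 t 0 = 0) \<and>
     (\<forall>\<epsilon>>0. \<exists>\<delta> \<tau>. \<delta> > 0 \<and> switching_time T \<tau> \<and>
        uniformly_confined G \<delta> \<tau> \<epsilon> \<and> uniformly_attracted G \<delta> \<tau>)"

end

theory Submission
  imports Defs "HOL-Computational_Algebra.Fundamental_Theorem_Algebra"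
begin

text \<open>Since the Jacobian \<open>A\<close> of the nominal field \<open>F\<close> at \<open>0\<close> has no eigenvalue on the imaginary axis, there is
  a symmetric bilinear form \<open>B\<close> with \<open>B x (A x) \<ge> |x|\<^sup>2\<close>. Asymptotic stability forces \<open>B\<close> to be negative
  definite, so \<open>P = - B\<close> is a quadratic Lyapunov function of \<open>F\<close> near \<open>0\<close>. The nominal field is the
  average of the subsystems \<open>h\<^sub>k = f + m \<kappa>\<^sub>k g\<^sub>k\<close>, which are Lipschitz near \<open>0\<close> and vanish there. Cut time into windows of
  a small fixed length \<open>l\<close> dividing \<open>T\<close>, so that the switching time is constant on each of them. In a
  window every subsystem is active for a time \<open>l / m\<close> up to a multiple of the switching time \<open>\<tau>\<close>, so
  \<open>P x x\<close> changes by at most \<open>(- l + O(l\<^sup>2) + O(\<tau>)) |x|\<^sup>2\<close> and decays geometrically once \<open>l\<close>, and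
  then \<open>\<tau>\<close>, are small.\<close>

section \<open>Absolutely continuous functions and Caratheodory solutions\<close>

lemma abs_continuous_onD:
  assumes "abs_continuous_on S z" "e > 0"
  shows "\<exists>d>0. \<forall>(n::nat) p q. (\<forall>i<n. p i \<le> q i \<and> {p i..q i} \<subseteq> S) \<longrightarrow>
       disjoint_family_on (\<lambda>i. {p i<..<q i}) {..<n} \<longrightarrow> (\<Sum>i<n. q i - p i) < d \<longrightarrow>
       (\<Sum>i<n. norm (z (q i) - z (p i))) < e"
  using assms(1)[unfolded abs_continuous_on_def, rule_format, OF assms(2)]
  unfolding imp_conjL .

lemma abs_continuous_on_subset:
  assumes "abs_continuous_on S z" "S' \<subseteq> S"
  shows "abs_continuous_on S' z"
  unfolding abs_continuous_on_def
proof (intro allI impI)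
  fix e :: real assume e: "0 < e"
  obtain d where d: "d > 0" and D: "\<forall>(n::nat) p q. (\<forall>i<n. p i \<le> q i \<and> {p i..q i} \<subseteq> S) \<longrightarrow>
     disjoint_family_on (\<lambda>i. {p i<..<q i}) {..<n} \<longrightarrow> (\<Sum>i<n. q i - p i) < d \<longrightarrow>
     (\<Sum>i<n. norm (z (q i) - z (p i))) < e"
    using abs_continuous_onD[OF assms(1) e] by (elim exE conjE)
  show "\<exists>d>0. \<forall>(n::nat) p q. (\<forall>i<n. p i \<le> q i \<and> {p i..q i} \<subseteq> S') \<and>
     disjoint_family_on (\<lambda>i. {p i<..<q i}) {..<n} \<and> (\<Sum>i<n. q i - p i) < d \<longrightarrow>
     (\<Sum>i<n. norm (z (q i) - z (p i))) < e"
  proof (intro exI conjI allI impI, fact d)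
    fix n :: nat and p q :: "nat \<Rightarrow> real"
    assume *: "(\<forall>i<n. p i \<le> q i \<and> {p i..q i} \<subseteq> S') \<and>
     disjoint_family_on (\<lambda>i. {p i<..<q i}) {..<n} \<and> (\<Sum>i<n. q i - p i) < d"
    show "(\<Sum>i<n. norm (z (q i) - z (p i))) < e"
      by (rule D[rule_format]) (use * assms(2) in auto)
  qed
qed

lemma abs_continuous_on_imp_continuous_on:
  assumes "abs_continuous_on {a..b} z"
  shows "continuous_on {a..b} z"
  unfolding continuous_on_iff
proof (intro ballI allI impI)
  fix x and e :: real assume x: "x \<in> {a..b}" and e: "0 < e"
  obtain d where d: "d > 0" and D: "\<forall>(n::nat) p q. (\<forall>i<n. p i \<le> q i \<and> {p i..q i} \<subseteq> {a..b}) \<longrightarrow>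
     disjoint_family_on (\<lambda>i. {p i<..<q i}) {..<n} \<longrightarrow> (\<Sum>i<n. q i - p i) < d \<longrightarrow>
     (\<Sum>i<n. norm (z (q i) - z (p i))) < e"
    using abs_continuous_onD[OF assms e] by (elim exE conjE)
  \<comment> \<open>The single interval between \<open>x\<close> and \<open>y\<close>, in either
    order, is an admissible family.\<close>
  have "dist (z y) (z x) < e" if y: "y \<in> {a..b}" "dist y x < d" for y
    using D[rule_format, of 1 "\<lambda>_. min x y" "\<lambda>_. max x y"] x y
    by (cases "x \<le> y") (auto simp: disjoint_family_on_def dist_norm norm_minus_commute)
  then show "\<exists>d>0. \<forall>x'\<in>{a..b}. dist x' x < d \<longrightarrow> dist (z x') (z x) < e"
    using d by blast
qed

text \<open>Henstock's definition of the integral makes the fundamental theorem direct: tags outside \<open>N\<close> are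
  controlled by the derivative, and the intervals tagged in \<open>N\<close> lie in an open set of small measure,
  where absolute continuity controls the increments.\<close>

lemma abs_continuous_on_has_integral:
  fixes z :: "real \<Rightarrow> 'a::banach"
  assumes ab: "a \<le> b" and ac: "abs_continuous_on {a..b} z" and N: "negligible N"
    and der: "\<And>t. t \<in> {a..b} - N \<Longrightarrow> (z has_vector_derivative z' t) (at t within {a..b})"
  shows "(z' has_integral (z b - z a)) {a..b}"
proof -
  \<comment> \<open>Values of \<open>z'\<close> on \<open>N\<close> are uncontrolled, so they are
    replaced by 0; the final spike over \<open>N\<close> restores them.\<close>
  define h where "h t = (if t \<in> N then 0 else z' t)" for t
  have "(h has_integral (z b - z a)) {a..b}"
    unfolding has_integral_real
  proof (intro allI impI)
    fix e :: real assume e: "0 < e"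
    \<comment> \<open>Tags outside \<open>N\<close> may use up e/2 of the error; the summand 1 keeps
      the denominator positive when \<open>a = b\<close>.\<close>
    define e' where "e' = e / (2 * (b - a) + 1)"
    have e': "e' > 0" "e' * (b - a) < e / 2"
      using e ab by (simp_all add: e'_def divide_simps)
    obtain d where d: "d > 0" and D: "\<forall>(n::nat) p q. (\<forall>i<n. p i \<le> q i \<and> {p i..q i} \<subseteq> {a..b}) \<longrightarrow>
     disjoint_family_on (\<lambda>i. {p i<..<q i}) {..<n} \<longrightarrow> (\<Sum>i<n. q i - p i) < d \<longrightarrow>
     (\<Sum>i<n. norm (z (q i) - z (p i))) < e / 2"
    using abs_continuous_onD[OF ac half_gt_zero[OF e]] by (elim exE conjE)
    have "N \<in> lmeasurable" "measure lebesgue N = 0"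
      using N by (auto simp: negligible_iff_measure)
    \<comment> \<open>Outer regularity: \<open>G\<close> surrounds \<open>N\<close>, and its measure
      is below the threshold \<open>d\<close> of absolute continuity.\<close>
    then obtain G where "open G" "N \<subseteq> G" "G - N \<in> lmeasurable" "emeasure lebesgue (G - N) < ennreal d"
      using sets_lebesgue_outer_open[of N d] d by blast
    moreover from this have "G \<in> lmeasurable"
      using fmeasurable.Un[of N lebesgue "G - N"] \<open>N \<in> lmeasurable\<close> by (simp add: Un_absorb1)
    ultimately have G: "open G" "N \<subseteq> G" "G \<in> lmeasurable" "measure lebesgue G < d"
      using N d by (auto simp: measure_Diff_null_set negligible_iff_null_sets emeasure_eq_measure2 ennreal_less_iff)
    have "\<exists>r>0. \<forall>y\<in>{a..b}. \<bar>y - t\<bar> < r \<longrightarrow> norm (z y - z t - (y - t) *\<^sub>R z' t) \<le> e' * \<bar>y - t\<bar>"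
      if "t \<in> {a..b} - N" for t
      using der[OF that] e' unfolding has_vector_derivative_def has_derivative_within_alt by auto
    then obtain r where r: "\<And>t. t \<in> {a..b} - N \<Longrightarrow> r t > 0"
      "\<And>t y. t \<in> {a..b} - N \<Longrightarrow> y \<in> {a..b} \<Longrightarrow> \<bar>y - t\<bar> < r t \<Longrightarrow>
          norm (z y - z t - (y - t) *\<^sub>R z' t) \<le> e' * \<bar>y - t\<bar>"
      by metis
    \<comment> \<open>A tag in \<open>N\<close> confines its interval to \<open>G\<close>; any other
      tag in \<open>{a..b}\<close> confines it to where its derivative estimate holds.\<close>
    define \<gamma> where "\<gamma> t = (if t \<in> N then G else if t \<in> {a..b} then ball t (r t) else UNIV)" for t
    have "gauge \<gamma>"
      unfolding gauge_def \<gamma>_def using G r(1) by auto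
    moreover have "norm ((\<Sum>(x,K)\<in>p. measure lborel K *\<^sub>R h x) - (z b - z a)) < e"
      if p: "p tagged_division_of {a..b}" "\<gamma> fine p" for p
    proof -
      have fin: "finite p" using p(1) by blast
      define J where "J = {xK \<in> p. fst xK \<in> N}"
      have J: "J \<subseteq> p" "finite J" using fin by (auto simp: J_def)
      have iv: "\<exists>u v. K = {u..v} \<and> u \<le> v \<and> u \<in> {a..b} \<and> v \<in> {a..b} \<and> x \<in> {u..v} \<and>
          K \<subseteq> \<gamma> x \<and> x \<in> {a..b} \<and> {u..v} \<subseteq> {a..b}"
        if "(x, K) \<in> p" for x K
      proof -
        have "x \<in> K" "K \<subseteq> {a..b}" "\<exists>u v. K = cbox u v" "K \<subseteq> \<gamma> x"
          using tagged_division_ofD(2-4)[OF p(1) that] fineD[OF p(2) that] by auto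
        then show ?thesis by force
      qed
      have int_disj: "interior K \<inter> interior K' = {}" if "(x,K) \<in> p" "(x',K') \<in> p" "(x,K) \<noteq> (x',K')" for x K x' K'
        using tagged_division_ofD(5)[OF p(1)] that by blast
      \<comment> \<open>The increment \<open>z b - z a\<close> telescopes over the division, so the
        total error is the sum of the errors \<open>E\<close> of single intervals.\<close>
      define E where "E = (\<lambda>(x,K). measure lborel K *\<^sub>R h x - (z (Sup K) - z (Inf K)))"
      have "(\<Sum>(x,K)\<in>p. measure lborel K *\<^sub>R h x) - (z b - z a) = sum E p"
        unfolding additive_tagged_division_1[OF ab p(1), of z, symmetric]
        by (simp add: sum_subtractf[symmetric] E_def case_prod_unfold)
      also have "\<dots> = sum E (p - J) + sum E J"
        using fin J(1) by (simp add: sum.subset_diff)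
      finally have eq: "(\<Sum>(x,K)\<in>p. measure lborel K *\<^sub>R h x) - (z b - z a) = sum E (p - J) + sum E J" .
      have "norm (sum E (p - J)) \<le> (\<Sum>(x,K)\<in>p-J. e' * measure lborel K)"
      proof (rule sum_norm_le, clarify)
        fix x K assume xK: "(x, K) \<in> p" "(x, K) \<notin> J"
        then have xN: "x \<notin> N" by (auto simp: J_def)
        obtain u v where uv: "K = {u..v}" "u \<le> v" "u \<in> {a..b}" "v \<in> {a..b}" "x \<in> {u..v}" "K \<subseteq> \<gamma> x" "x \<in> {a..b}"
          using iv[OF xK(1)] by blast
        have "\<gamma> x = ball x (r x)" using xN uv by (auto simp: \<gamma>_def)
        then have uvr: "\<bar>u - x\<bar> < r x" "\<bar>v - x\<bar> < r x"
          using uv(6) uv(1,2) by (auto simp: subset_iff dist_real_def abs_minus_commute)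
        \<comment> \<open>The tag lies between \<open>u\<close> and \<open>v\<close>, so the
          distances in the two derivative estimates add up to the length of the interval.\<close>
        have "E (x, K) = (z u - z x - (u - x) *\<^sub>R z' x) - (z v - z x - (v - x) *\<^sub>R z' x)"
          using uv xN by (simp add: E_def h_def algebra_simps)
        also have "norm \<dots> \<le> e' * \<bar>u - x\<bar> + e' * \<bar>v - x\<bar>"
          using uv uvr xN by (intro order_trans[OF norm_triangle_ineq4 add_mono[OF r(2) r(2)]]) blast+
        also have "\<dots> = e' * measure lborel K"
          using uv by (simp add: algebra_simps)
        finally show "norm (E (x, K)) \<le> e' * measure lborel K" .
      qed
      also have "\<dots> \<le> (\<Sum>(x,K)\<in>p. e' * measure lborel K)"
        using fin e' by (intro sum_mono2) auto
      also have "\<dots> = e' * (b - a)"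
        using additive_content_tagged_division[of p a b] p(1) ab
        by (simp add: case_prod_unfold flip: sum_distrib_left interval_cbox)
      finally have s1: "norm (sum E (p - J)) < e / 2" using e'(2) by simp
      \<comment> \<open>Absolute continuity speaks of families indexed by naturals, so the intervals
        tagged in \<open>N\<close> are enumerated.\<close>
      obtain g where g: "bij_betw g {..<card J} J"
        using ex_bij_betw_nat_finite[OF J(2)] by (metis atLeast0LessThan)
      define P Q where "P i = Inf (snd (g i))" and "Q i = Sup (snd (g i))" for i
      have gJ: "g i \<in> J" if "i < card J" for i using g that by (auto simp: bij_betw_def)
      have PQ: "P i \<le> Q i \<and> snd (g i) = {P i..Q i} \<and> {P i..Q i} \<subseteq> {a..b} \<and> {P i..Q i} \<subseteq> G" if "i < card J" for i
      proof -
        obtain x K where xK: "g i = (x, K)" by fastforce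
        then have "(x, K) \<in> p" "x \<in> N" using gJ[OF that] by (auto simp: J_def)
        then show ?thesis using iv[of x K] xK by (auto simp: P_def Q_def \<gamma>_def)
      qed
      have disj: "disjoint_family_on (\<lambda>i. {P i<..<Q i}) {..<card J}"
        unfolding disjoint_family_on_def
      proof (intro ballI impI)
        fix i j assume ij: "i \<in> {..<card J}" "j \<in> {..<card J}" "i \<noteq> j"
        then have "g i \<noteq> g j" using g by (auto simp: bij_betw_def inj_on_def)
        then have "interior (snd (g i)) \<inter> interior (snd (g j)) = {}"
          using int_disj[of "fst (g i)" "snd (g i)" "fst (g j)" "snd (g j)"] gJ J(1) ij by auto
        then show "{P i<..<Q i} \<inter> {P j<..<Q j} = {}" using PQ ij by simp
      qed
      have lm: "{P i<..<Q i} \<in> lmeasurable" for i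
        by (rule lmeasurable_open) auto
      \<comment> \<open>Disjoint open intervals inside \<open>G\<close> have total length at most
        the measure of \<open>G\<close>, which is below \<open>d\<close>.\<close>
      have "(\<Sum>i<card J. Q i - P i) = (\<Sum>i<card J. measure lebesgue {P i<..<Q i})"
        using PQ by (intro sum.cong) auto
      also have "\<dots> = measure lebesgue (\<Union>i<card J. {P i<..<Q i})"
      proof (rule measure_finite_Union[symmetric])
        show "emeasure lebesgue {P i<..<Q i} \<noteq> \<infinity>" for i
          using fmeasurableD2[OF lm] unfolding infinity_ennreal_def .
      qed (use disj in auto)
      also have "\<dots> \<le> measure lebesgue G"
      proof (rule measure_mono_fmeasurable)
        have "{P i<..<Q i} \<subseteq> G" if "i < card J" for i
          using PQ[OF that] greaterThanLessThan_subseteq_atLeastAtMost_iff[of "P i" "Q i" "P i" "Q i"] by blast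
        then show "(\<Union>i<card J. {P i<..<Q i}) \<subseteq> G" by blast
      qed (use lm G in \<open>auto intro!: sets.finite_UN\<close>)
      finally have "(\<Sum>i<card J. Q i - P i) < d" using G(4) by linarith
      then have "(\<Sum>i<card J. norm (z (Q i) - z (P i))) < e / 2"
        using PQ disj by (intro D[rule_format]) blast+
      moreover have "norm (sum E J) \<le> (\<Sum>i<card J. norm (z (Q i) - z (P i)))"
        unfolding sum.reindex_bij_betw[OF g, symmetric]
      proof (rule sum_norm_le)
        fix i assume i: "i \<in> {..<card J}"
        obtain x K where xK: "g i = (x, K)" by fastforce
        then have "x \<in> N" using gJ i by (fastforce simp: J_def)
        then have "h x = 0" by (simp add: h_def)
        then show "norm (E (g i)) \<le> norm (z (Q i) - z (P i))"
          by (simp add: E_def xK P_def Q_def norm_minus_commute)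
      qed
      ultimately show ?thesis
        unfolding eq using s1 norm_triangle_ineq[of "sum E (p - J)" "sum E J"] by linarith
    qed
    ultimately show "\<exists>\<gamma>. gauge \<gamma> \<and> (\<forall>D. D tagged_division_of {a..b} \<and> \<gamma> fine D \<longrightarrow>
          norm ((\<Sum>(x, k)\<in>D. measure lborel k *\<^sub>R h x) - (z b - z a)) < e)"
      by (intro exI[of _ \<gamma>] conjI allI impI) (assumption, elim conjE)
  qed
  then show ?thesis
    by (rule has_integral_spike[OF N, rotated]) (auto simp: h_def)
qed

text \<open>The exceptional times form a null set, which
  \<open>abs_continuous_on_has_integral\<close> tolerates. Together with continuity, this integral
  equation replaces the almost everywhere derivative in all later estimates.\<close>

lemma caratheodory_solution_has_integral:
  assumes sol: "caratheodory_solution F t0 x0 z" and ab: "t0 \<le> a" "a \<le> b"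
  shows "((\<lambda>t. F t (z t)) has_integral (z b - z a)) {a..b}"
proof -
  define N where "N = {t. \<not> (t \<ge> t0 \<longrightarrow> (z has_vector_derivative F t (z t)) (at t within {t0..}))}"
  have "N \<in> null_sets lebesgue"
    using sol unfolding caratheodory_solution_def N_def completion.AE_iff_null_sets by auto
  then have N: "negligible N" by (simp add: negligible_iff_null_sets)
  have "abs_continuous_on {t0..b} z" using sol ab by (simp add: caratheodory_solution_def)
  then have "abs_continuous_on {a..b} z"
    by (rule abs_continuous_on_subset) (use ab in auto)
  then show ?thesis
  proof (rule abs_continuous_on_has_integral[OF ab(2) _ N])
    fix t assume "t \<in> {a..b} - N"
    then have "(z has_vector_derivative F t (z t)) (at t within {t0..})" using ab by (auto simp: N_def)
    then show "(z has_vector_derivative F t (z t)) (at t within {a..b})"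
      by (rule has_vector_derivative_within_subset) (use ab in auto)
  qed
qed

lemma caratheodory_solution_continuous_on:
  assumes "caratheodory_solution F t0 x0 z" "t0 \<le> a"
  shows "continuous_on {a..b} z"
proof (cases "a \<le> b")
  case True
  then have "continuous_on {t0..b} z"
    using assms by (auto simp: caratheodory_solution_def intro!: abs_continuous_on_imp_continuous_on)
  then show ?thesis by (rule continuous_on_subset) (use assms in auto)
qed auto

section \<open>A quadratic form growing along a hyperbolic linear flow\<close>

text \<open>The product of the commuting matrices M - l over the list, applied to a vector with the
  head factor first.\<close>

primrec shift_prod :: "complex^'n^'n \<Rightarrow> complex list \<Rightarrow> complex^'n \<Rightarrow> complex^'n" where
  "shift_prod M [] v = v"
| "shift_prod M (l # ls) v = shift_prod M ls (M *v v - l *s v)"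

lemma shift_prod_diff: "shift_prod M ls (v - w) = shift_prod M ls v - shift_prod M ls w"
proof (induction ls arbitrary: v w)
  case (Cons l ls)
  have "M *v (v - w) - l *s (v - w) = (M *v v - l *s v) - (M *v w - l *s w)"
    by (simp add: matrix_vector_mult_diff_distrib vec.scale_right_diff_distrib)
  then show ?case by (simp only: shift_prod.simps Cons.IH)
qed simp

lemma shift_prod_scale: "shift_prod M ls (c *s v) = c *s shift_prod M ls v"
proof (induction ls arbitrary: v)
  case (Cons l ls)
  have "M *v (c *s v) - l *s (c *s v) = c *s (M *v v - l *s v)"
    by (simp add: vector_scalar_commute vec.scale_right_diff_distrib mult.commute)
  then show ?case by (simp only: shift_prod.simps Cons.IH)
qed simp

lemma shift_prod_mult: "shift_prod M ls (M *v v) = M *v shift_prod M ls v"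
proof (induction ls arbitrary: v)
  case (Cons l ls)
  have "M *v (M *v v) - l *s (M *v v) = M *v (M *v v - l *s v)"
    by (simp add: vector_scalar_commute matrix_vector_mult_diff_distrib)
  then show ?case by (simp only: shift_prod.simps Cons.IH)
qed simp

section \<open>Polynomials in a matrix and annihilation by shifted factors\<close>

definition poly_apply :: "complex^'n^'n \<Rightarrow> complex poly \<Rightarrow> complex^'n \<Rightarrow> complex^'n" where
  "poly_apply M p v = (\<Sum>i\<le>degree p. coeff p i *s (((*v) M) ^^ i) v)"

lemma poly_apply_eq:
  assumes "degree p \<le> N"
  shows "poly_apply M p v = (\<Sum>i\<le>N. coeff p i *s (((*v) M) ^^ i) v)"
  unfolding poly_apply_def
  by (rule sum.mono_neutral_left) (use assms in \<open>auto simp: coeff_eq_0\<close>)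

lemma poly_apply_add: "poly_apply M (p + q) v = poly_apply M p v + poly_apply M q v"
proof -
  define N where "N = max (degree p) (degree q)"
  have "degree p \<le> N" "degree q \<le> N" "degree (p + q) \<le> N"
    by (auto simp: N_def degree_add_le)
  then show ?thesis
    by (simp add: poly_apply_eq[of _ N] vec.scale_left_distrib sum.distrib)
qed

lemma poly_apply_smult: "poly_apply M (smult c p) v = c *s poly_apply M p v"
proof -
  have "degree (smult c p) \<le> degree p" by simp
  then show ?thesis
    by (simp add: poly_apply_eq[of _ "degree p"] vec.scale_sum_right)
qed

lemma poly_apply_pCons_0: "poly_apply M (pCons 0 p) v = poly_apply M p (M *v v)"
proof -
  have "degree (pCons 0 p) \<le> Suc (degree p)" by (rule degree_pCons_le)
  then have "poly_apply M (pCons 0 p) v =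
      (\<Sum>i\<le>Suc (degree p). coeff (pCons 0 p) i *s (((*v) M) ^^ i) v)"
    by (rule poly_apply_eq)
  also have "\<dots> = (\<Sum>i\<le>degree p. coeff p i *s (((*v) M) ^^ i) (M *v v))"
    by (subst sum.atMost_Suc_shift) (simp add: funpow_swap1)
  finally show ?thesis by (simp add: poly_apply_def)
qed

text \<open>Links factorization of polynomials to \<open>shift_prod\<close>: a factor X - l turns p
  into X p - l p, and multiplication by X means applying \<open>M\<close> first.\<close>

lemma poly_apply_prod_list:
  "poly_apply M (\<Prod>l\<leftarrow>ls. [:- l, 1:]) v = shift_prod M ls v"
proof (induction ls arbitrary: v)
  case Nil
  then show ?case by (simp add: poly_apply_def)
next
  case (Cons l ls)
  have "(\<Prod>l\<leftarrow>l # ls. [:- l, 1:]) = smult (- l) (\<Prod>l\<leftarrow>ls. [:- l, 1:]) + pCons 0 (\<Prod>l\<leftarrow>ls. [:- l, 1:])"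
    by simp
  then show ?case
    by (simp only: poly_apply_add poly_apply_smult poly_apply_pCons_0 Cons.IH shift_prod.simps
        shift_prod_diff shift_prod_scale) simp
qed

text \<open>One vector more than the dimension is dependent. The relation is over indices because
  values may repeat, and a repetition is itself a relation.\<close>

lemma exists_linear_relation:
  fixes X :: "nat \<Rightarrow> 'a::euclidean_space"
  shows "\<exists>c. (\<exists>i\<le>DIM('a). c i \<noteq> 0) \<and> (\<Sum>i\<le>DIM('a). c i *\<^sub>R X i) = 0"
proof (cases "inj_on X {..DIM('a)}")
  case True
  then have "card (X ` {..DIM('a)}) > DIM('a)" by (simp add: card_image)
  then have "dependent (X ` {..DIM('a)})" using dependent_biggerset by blast
  then obtain u where u: "\<exists>x\<in>X ` {..DIM('a)}. u x \<noteq> 0" "(\<Sum>x\<in>X ` {..DIM('a)}. u x *\<^sub>R x) = 0"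
    by (auto simp: dependent_finite)
  then show ?thesis
    by (intro exI[of _ "u \<circ> X"]) (auto simp: sum.reindex[OF True])
next
  case False
  then obtain i j where ij: "i \<le> DIM('a)" "j \<le> DIM('a)" "i \<noteq> j" "X i = X j"
    by (auto simp: inj_on_def)
  define c where "c k = (if k = i then 1 else if k = j then - 1 else 0 :: real)" for k
  have "(\<Sum>k\<le>DIM('a). c k *\<^sub>R X k) = (\<Sum>k\<in>{i,j}. c k *\<^sub>R X k)"
    by (rule sum.mono_neutral_right) (use ij in \<open>auto simp: c_def\<close>)
  also have "\<dots> = 0" using ij by (simp add: c_def)
  finally show ?thesis using ij(1) by (intro exI[of _ c]) (auto simp: c_def)
qed

text \<open>Powers of \<open>M\<close>, one more than the real dimension of the matrix space, are
  dependent. This gives a nonzero annihilating polynomial, which splits into linear factors over the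
  complex numbers.\<close>

lemma exists_shift_prod_zero:
  fixes M :: "complex^'n^'n"
  shows "\<exists>ls. \<forall>v. shift_prod M ls v = 0"
proof -
  define X where "X i = (((**) M) ^^ i) (mat 1)" for i
  have X: "X i *v v = (((*v) M) ^^ i) v" for i v
    by (induction i) (auto simp: X_def simp flip: matrix_vector_mul_assoc)
  let ?N = "DIM(complex^'n^'n)"
  obtain c where c: "\<exists>i\<le>?N. c i \<noteq> 0" "(\<Sum>i\<le>?N. c i *\<^sub>R X i) = 0"
    using exists_linear_relation[of X] by blast
  define p where "p = (\<Sum>i\<le>?N. monom (complex_of_real (c i)) i)"
  have cp: "coeff p i = (if i \<le> ?N then complex_of_real (c i) else 0)" for i
    by (simp add: p_def coeff_sum)
  then have dp: "degree p \<le> ?N" by (intro degree_le) auto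
  have "p \<noteq> 0" using c(1) cp by (metis coeff_0 of_real_eq_0_iff)
  have lin: "linear (\<lambda>Y :: complex^'n^'n. Y *v v)" for v
    by (rule linearI) (simp_all add: matrix_vector_mult_def vec_eq_iff sum.distrib algebra_simps scaleR_sum_right)
  have "poly_apply M p v = 0" for v
  proof -
    have "poly_apply M p v = (\<Sum>i\<le>?N. c i *\<^sub>R (X i *v v))"
      unfolding poly_apply_eq[OF dp] by (intro sum.cong) (auto simp: cp X vec_eq_iff complex_eq_iff)
    also have "\<dots> = (\<Sum>i\<le>?N. c i *\<^sub>R X i) *v v"
      by (simp add: linear_sum[OF lin] linear_scale[OF lin])
    finally show ?thesis using c(2) by (simp add: matrix_vector_mult_0)
  qed
  moreover obtain ls where "mset ls = proots p" using ex_mset by blast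
  then have "smult (lead_coeff p) (\<Prod>l\<leftarrow>ls. [:- l, 1:]) = p"
    using complex_poly_decompose_multiset[of p] by (metis mset_map prod_mset_prod_list)
  ultimately have "lead_coeff p *s shift_prod M ls v = 0" for v
    using poly_apply_prod_list[of M ls v] poly_apply_smult[of M "lead_coeff p"] by metis
  then show ?thesis using \<open>p \<noteq> 0\<close> by (auto simp: vec.scale_eq_0_iff)
qed

lemma shift_prod_filter_zero:
  assumes "\<And>l v. Re l = 0 \<Longrightarrow> M *v v = l *s v \<Longrightarrow> v = 0" and "shift_prod M ls v = 0"
  shows "shift_prod M (filter (\<lambda>l. Re l \<noteq> 0) ls) v = 0"
  using assms(2)
proof (induction ls arbitrary: v)
  case (Cons l ls)
  show ?case
  proof (cases "Re l = 0")
    case True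
    have "M *v shift_prod M ls v = l *s shift_prod M ls v"
      using Cons.prems by (simp add: shift_prod_diff shift_prod_scale shift_prod_mult)
    then show ?thesis using assms(1)[OF True] Cons.IH True by simp
  qed (use Cons in simp)
qed simp

text \<open>In the real inner product, multiplication by i moves every vector to an orthogonal one,
  so only the real part of \<open>l\<close> survives.\<close>

lemma inner_scalar_mult_complex:
  fixes v :: "complex^'n"
  shows "v \<bullet> (l *s v) = Re l * (v \<bullet> v)"
  by (simp add: inner_vec_def sum_distrib_left inner_complex_def algebra_simps)

text \<open>With \<open>w\<^sub>j = shift_prod M [l\<^sub>1, \<dots>, l\<^sub>j] v\<close> the flow \<open>v' = M v\<close> gives \<open>w\<^sub>j' = l\<^sub>j\<^sub>+\<^sub>1 w\<^sub>j + w\<^sub>j\<^sub>+\<^sub>1\<close>, so a weighted sum of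
  \<open>\<plusminus> |w\<^sub>j|\<^sup>2\<close> with signs \<open>sgn (Re l\<^sub>j\<^sub>+\<^sub>1)\<close> grows along the flow, without any choice of a basis.\<close>

lemma exists_lyapunov_form_shift_prod:
  fixes M :: "complex^'n^'n"
  assumes "\<forall>l\<in>set ls. Re l \<noteq> 0"
  shows "\<exists>B K. bilinear B \<and> (\<forall>u v. B u v = B v u) \<and> K \<ge> 0 \<and>
    (\<forall>v. (norm v)\<^sup>2 - K * (norm (shift_prod M ls v))\<^sup>2 \<le> B v (M *v v))"
  using assms
proof (induction ls)
  case Nil
  \<comment> \<open>For the empty list \<open>shift_prod\<close> is the identity, so
    \<open>K = 1\<close> makes the left side 0 and the zero form suffices.\<close>
  show ?case
    by (intro exI[of _ "\<lambda>_ _. 0"] exI[of _ 1]) (auto simp: bilinear_def linear_zero)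
next
  case (Cons l ls)
  then obtain B K where B: "bilinear B" "\<And>u v. B u v = B v u" "K \<ge> 0"
    "\<And>v. (norm v)\<^sup>2 - K * (norm (shift_prod M ls v))\<^sup>2 \<le> B v (M *v v)" by auto
  have l: "Re l \<noteq> 0" using Cons.prems by simp
  define D where "D v = M *v v - l *s v" for v
  have D: "linear D"
    by (rule linearI) (simp_all add: D_def vec_eq_iff matrix_vector_mult_def sum.distrib algebra_simps scaleR_sum_right)
  \<comment> \<open>Then a |Re l| = 2: the diagonal term yields 2 |v|^2, one half of which pays for
    the cross term.\<close>
  define a where "a = 2 / \<bar>Re l\<bar>"
  have a: "a > 0" using l by (simp add: a_def)
  define B' where "B' u v = (sgn (Re l) * a) * (u \<bullet> v) + a\<^sup>2 / 4 * B (D u) (D v)" for u v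
  have "linear (\<lambda>v. B' u v)" for u
  proof -
    have "linear (\<lambda>v. B (D u) (D v))"
      using linear_compose[OF D, of "B (D u)"] B(1) by (simp add: bilinear_def comp_def)
    then show ?thesis
      by (auto simp: B'_def linear_iff inner_add_right algebra_simps)
  qed
  moreover have sym: "B' u v = B' v u" for u v
    using B(2) by (simp add: B'_def inner_commute)
  ultimately have "bilinear B'" by (simp add: bilinear_def sym)
  moreover have "(norm v)\<^sup>2 - (a\<^sup>2 / 4 * K) * (norm (shift_prod M (l # ls) v))\<^sup>2 \<le> B' v (M *v v)" for v
  proof -
    let ?w = "D v"
    have "M *v v = l *s v + ?w" by (simp add: D_def)
    then have "v \<bullet> (M *v v) = Re l * (norm v)\<^sup>2 + v \<bullet> ?w"
      by (simp add: inner_add_right inner_scalar_mult_complex power2_norm_eq_inner)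
    then have "(sgn (Re l) * a) * (v \<bullet> (M *v v)) = 2 * (norm v)\<^sup>2 + sgn (Re l) * a * (v \<bullet> ?w)"
      using l by (simp add: a_def sgn_if field_simps)
    moreover have "\<bar>sgn (Re l) * a * (v \<bullet> ?w)\<bar> \<le> a * (norm v * norm ?w)"
      using l a Cauchy_Schwarz_ineq2[of v ?w] by (simp add: abs_mult abs_sgn_eq)
    moreover have "D (M *v v) = M *v ?w"
      by (simp add: D_def matrix_vector_mult_diff_distrib vector_scalar_commute)
    then have "a\<^sup>2 / 4 * ((norm ?w)\<^sup>2 - K * (norm (shift_prod M ls ?w))\<^sup>2) \<le> a\<^sup>2 / 4 * B ?w (D (M *v v))"
      using B(4)[of ?w] by (intro mult_left_mono) auto
    \<comment> \<open>Young's inequality for the cross term; the a^2 / 4 it puts on |w|^2 is the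
      weight of \<open>B\<close> in \<open>B'\<close>.\<close>
    moreover have "0 \<le> (norm v - a / 2 * norm ?w)\<^sup>2" by simp
    ultimately show ?thesis
      by (simp add: B'_def power2_eq_square algebra_simps flip: D_def)
  qed
  ultimately show ?case using sym B(3) by (intro exI[of _ B'] exI[of _ "a\<^sup>2 / 4 * K"]) auto
qed

text \<open>The isometric embedding \<open>J\<close> of real into complex vectors intertwines
  \<open>A\<close> with its complexification, so a form found on the complex space can be pulled
  back.\<close>

lemma exists_lyapunov_form:
  fixes A :: "real^'n^'n"
  assumes "\<not> (\<exists>(l::complex) (v::complex^'n). Re l = 0 \<and> v \<noteq> 0 \<and>
          map_matrix complex_of_real A *v v = l *s v)"
  shows "\<exists>B. bounded_bilinear B \<and> (\<forall>x y. B x y = B y x) \<and> (\<forall>x. (norm x)\<^sup>2 \<le> B x (A *v x))"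
proof -
  define M where "M = map_matrix complex_of_real A"
  define J where "J x = (\<chi> i. complex_of_real (x $ i))" for x :: "real^'n"
  obtain ls where "\<And>v. shift_prod M ls v = 0" using exists_shift_prod_zero by blast
  then have ls: "shift_prod M (filter (\<lambda>l. Re l \<noteq> 0) ls) v = 0" for v
    by (rule shift_prod_filter_zero[rotated]) (use assms in \<open>auto simp: M_def\<close>)
  \<comment> \<open>The remaining product still kills every vector, so the defect term with
    \<open>K\<close> vanishes.\<close>
  obtain B where B: "bilinear B" "\<And>u v. B u v = B v u"
    "\<And>v. (norm v)\<^sup>2 \<le> B v (M *v v)"
    using exists_lyapunov_form_shift_prod[of "filter (\<lambda>l. Re l \<noteq> 0) ls" M] by (auto simp: ls)
  have J: "linear J" by (rule linearI) (simp_all add: J_def vec_eq_iff complex_eq_iff)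
  have JA: "J (A *v x) = M *v J x" for x
    by (simp add: J_def M_def vec_eq_iff matrix_vector_mult_def map_matrix_def)
  have nJ: "norm (J x) = norm x" for x
    by (simp add: J_def norm_vec_def L2_set_def)
  have "linear (B u \<circ> J)" "linear ((\<lambda>u. B u v) \<circ> J)" for u v
    using B(1) by (auto intro!: linear_compose[OF J] simp: bilinear_def)
  then have "bilinear (\<lambda>x y. B (J x) (J y))" by (simp add: bilinear_def comp_def)
  then show ?thesis
    using B(2) B(3)[of "J _"] by (intro exI[of _ "\<lambda>x y. B (J x) (J y)"]) (auto simp: bilinear_conv_bounded_bilinear JA nJ)
qed

section \<open>Negative definiteness from asymptotic stability\<close>

text \<open>The remainder of the linearization is o(|x|). Near 0 it is at most |x| / (2 K), so
  passing through \<open>B\<close> it costs at most half of the margin |x|^2.\<close>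

lemma dissipation_near_equilibrium:
  fixes F :: "'a::euclidean_space \<Rightarrow> 'a"
  assumes F: "(F has_derivative A) (at 0)" "F 0 = 0"
    and B: "bounded_bilinear B" "\<And>x. (norm x)\<^sup>2 \<le> B x (A x)"
  shows "\<exists>r>0. \<forall>x. norm x \<le> r \<longrightarrow> (norm x)\<^sup>2 / 2 \<le> (B x (F x) :: real)"
proof -
  obtain K where K: "K > 0" "\<And>x y. norm (B x y) \<le> norm x * norm y * K"
    using bounded_bilinear.pos_bounded[OF B(1)] by blast
  have "1 / (2 * K) > 0" using K by simp
  then obtain d where d: "d > 0" "\<And>x. norm x < d \<Longrightarrow> norm (F x - A x) \<le> 1 / (2 * K) * norm x"
    using F unfolding has_derivative_at_alt by (metis diff_zero)
  have "(norm x)\<^sup>2 / 2 \<le> B x (F x)" if "norm x \<le> d / 2" for x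
  proof -
    have "B x (F x) = B x (A x) + B x (F x - A x)"
      by (simp add: bounded_bilinear.diff_right[OF B(1)])
    moreover have "\<bar>B x (F x - A x)\<bar> \<le> norm x * norm (F x - A x) * K" using K(2) by simp
    moreover have "norm (F x - A x) \<le> 1 / (2 * K) * norm x" using d that by auto
    then have "norm x * norm (F x - A x) * K \<le> norm x * (1 / (2 * K) * norm x) * K"
      using K by (intro mult_right_mono mult_left_mono) auto
    moreover have "norm x * (1 / (2 * K) * norm x) * K = (norm x)\<^sup>2 / 2"
      using K by (simp add: power2_eq_square)
    ultimately show ?thesis using B(2)[of x] by linarith
  qed
  then show ?thesis using d(1) by (intro exI[of _ "d / 2"]) auto
qed

text \<open>The minimum over the compact unit sphere is positive, and homogeneity of degree 2
  extends it to all vectors.\<close>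

lemma positive_form_coercive:
  fixes P :: "'a::euclidean_space \<Rightarrow> 'a \<Rightarrow> real"
  assumes P: "bounded_bilinear P" and pos: "\<And>x. x \<noteq> 0 \<Longrightarrow> P x x > 0"
  shows "\<exists>c>0. \<forall>x. c * (norm x)\<^sup>2 \<le> P x x"
proof -
  interpret bounded_bilinear P by fact
  have "continuous_on (sphere 0 1) (\<lambda>x. P x x)" by (intro continuous_on continuous_intros)
  then obtain u where u: "u \<in> sphere 0 1" "\<And>x. x \<in> sphere 0 1 \<Longrightarrow> P u u \<le> P x x"
    using continuous_attains_inf[of "sphere (0::'a) 1" "\<lambda>x. P x x"] by (auto simp: sphere_eq_empty)
  have "P u u * (norm x)\<^sup>2 \<le> P x x" for x
  proof (cases "x = 0")
    case False
    then have "P u u \<le> P (x /\<^sub>R norm x) (x /\<^sub>R norm x)" by (intro u) simp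
    also have "\<dots> = P x x / (norm x)\<^sup>2"
      by (simp add: scaleR_left scaleR_right power2_eq_square divide_simps)
    finally show ?thesis using False by (simp add: field_simps)
  qed (simp add: zero_left)
  moreover have "P u u > 0" using u(1) by (intro pos) auto
  ultimately show ?thesis by blast
qed

text \<open>For a continuous autonomous field the integrand is continuous in time, so the derivative
  exists everywhere and the mean value theorem becomes available.\<close>

lemma caratheodory_solution_has_vector_derivative:
  fixes F :: "'a::euclidean_space \<Rightarrow> 'a"
  assumes sol: "caratheodory_solution (\<lambda>_. F) 0 x0 z" and cont: "continuous_on S F"
    and S: "\<And>t. t \<ge> 0 \<Longrightarrow> z t \<in> S" and t: "t \<in> {0..b}"
  shows "(z has_vector_derivative F (z t)) (at t within {0..b})"
proof -
  have "continuous_on {0..b} (\<lambda>s. F (z s))"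
    by (rule continuous_on_compose2[OF cont caratheodory_solution_continuous_on[OF sol]]) (use S in auto)
  from integral_has_vector_derivative[OF this t]
  have "((\<lambda>u. z 0 + integral {0..u} (\<lambda>s. F (z s))) has_vector_derivative F (z t)) (at t within {0..b})"
    by (auto intro!: derivative_eq_intros)
  moreover have "z u = z 0 + integral {0..u} (\<lambda>s. F (z s))" if "u \<in> {0..b}" for u
    using caratheodory_solution_has_integral[OF sol, of 0 u] that by (simp add: integral_unique)
  ultimately show ?thesis
    using has_vector_derivative_transform[OF t] by (metis (no_types, lifting))
qed

text \<open>Along solutions the form is strictly increasing, so it cannot start at a nonnegative value and
  tend to \<open>0\<close>.\<close>

lemma lyapunov_form_negative:
  fixes F :: "'a::euclidean_space \<Rightarrow> 'a"
  assumes B: "bounded_bilinear B" and sym: "\<And>x y. B x y = B y x"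
    and r: "r > 0" and diss: "\<And>x. norm x \<le> r \<Longrightarrow> (norm x)\<^sup>2 / 2 \<le> (B x (F x) :: real)"
    and cont: "continuous_on (cball 0 r) F"
    and ex: "\<And>x0. \<exists>z. caratheodory_solution (\<lambda>_. F) 0 x0 z"
    and stable: "locally_asymptotically_stable F"
    and x: "x \<noteq> 0"
  shows "B x x < 0"
proof (rule ccontr)
  assume "\<not> B x x < 0"
  then have Bx: "B x x \<ge> 0" by simp
  interpret bounded_bilinear B by fact
  obtain d where d: "d > 0" "\<And>x0 z t. norm x0 \<le> d \<Longrightarrow> caratheodory_solution (\<lambda>_. F) 0 x0 z \<Longrightarrow>
      t \<ge> 0 \<Longrightarrow> norm (z t) \<le> r"
    using stable r unfolding locally_asymptotically_stable_def by meson
  obtain e where e: "e > 0" "\<And>x0 z. norm x0 \<le> e \<Longrightarrow> caratheodory_solution (\<lambda>_. F) 0 x0 z \<Longrightarrow>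
      (z \<longlongrightarrow> 0) at_top"
    using stable unfolding locally_asymptotically_stable_def by meson
  \<comment> \<open>Rescaling puts the point within both the stability and the attraction radius
    without changing the sign of the form.\<close>
  define x0 where "x0 = (min d e / norm x) *\<^sub>R x"
  have x0: "norm x0 = min d e" "x0 \<noteq> 0" using x d(1) e(1) by (auto simp: x0_def)
  have Bx0: "B x0 x0 \<ge> 0" using Bx d(1) e(1) by (simp add: x0_def scaleR_left scaleR_right)
  obtain z where z: "caratheodory_solution (\<lambda>_. F) 0 x0 z" using ex by blast
  have zr: "norm (z t) \<le> r" if "t \<ge> 0" for t using d(2)[OF _ z that] x0 by simp
  have z0: "z 0 = x0" using z by (simp add: caratheodory_solution_def)
  have lim: "((\<lambda>t. B (z t) (z t)) \<longlongrightarrow> 0) at_top"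
    using tendsto[OF e(2)[OF _ z] e(2)[OF _ z]] x0 by (simp add: zero_left)
  have der: "((\<lambda>t. B (z t) (z t)) has_vector_derivative 2 * B (z t) (F (z t))) (at t within {0..b})"
    if "t \<in> {0..b}" for t b
    using has_vector_derivative[OF caratheodory_solution_has_vector_derivative[OF z cont _ that]
        caratheodory_solution_has_vector_derivative[OF z cont _ that]] zr
    by (simp add: sym[of "F (z t)"])
  have incr: "\<exists>s\<in>{a<..<b}. (b - a) * (norm (z s))\<^sup>2 \<le> B (z b) (z b) - B (z a) (z a)" if "0 \<le> a" "a < b" for a b
  proof -
    have "((\<lambda>t. B (z t) (z t)) has_derivative (\<lambda>h. h * (2 * B (z t) (F (z t))))) (at t within {a..b})"
      if "t \<in> {a..b}" for t
      using has_vector_derivative_within_subset[OF der[of t b], of "{a..b}"] that \<open>0 \<le> a\<close>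
      by (simp add: has_vector_derivative_def)
    from mvt_simple[OF \<open>a < b\<close>, of "\<lambda>t. B (z t) (z t)" "\<lambda>t h. h * (2 * B (z t) (F (z t)))"] this
    obtain s where s: "s \<in> {a<..<b}" "B (z b) (z b) - B (z a) (z a) = (b - a) * (2 * B (z s) (F (z s)))"
      by auto
    have "(norm (z s))\<^sup>2 \<le> 2 * B (z s) (F (z s))" using diss[OF zr[of s]] s(1) that by simp
    then have "(b - a) * (norm (z s))\<^sup>2 \<le> (b - a) * (2 * B (z s) (F (z s)))"
      using that by (intro mult_left_mono) auto
    then show ?thesis using s by auto
  qed
  \<comment> \<open>Near time 0 the state is still nonzero, so the increase given by
    \<open>incr\<close> is strict there; from \<open>b\<close> on it is enough that the form does
    not decrease.\<close>
  have "continuous_on {0..1} z" by (rule caratheodory_solution_continuous_on[OF z]) simp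
  then obtain q where q: "q > 0" "\<And>s. s \<in> {0..1} \<Longrightarrow> dist s 0 < q \<Longrightarrow> dist (z s) (z 0) < norm x0"
    using x0(2) unfolding continuous_on_iff by (metis atLeastAtMost_iff order_refl zero_le_one zero_less_norm_iff)
  define b where "b = min 1 (q / 2)"
  have b: "b > 0" using q by (simp add: b_def)
  obtain s where s: "s \<in> {0<..<b}" "b * (norm (z s))\<^sup>2 \<le> B (z b) (z b) - B (z 0) (z 0)"
    using incr[of 0 b] b by auto
  have "dist (z s) (z 0) < norm x0" using s(1) q by (intro q(2)) (auto simp: b_def)
  then have "z s \<noteq> 0" by (auto simp: z0 dist_norm)
  then have Vb: "B (z b) (z b) > 0" using s(2) b Bx0 z0 by (smt (verit) mult_pos_pos zero_less_norm_iff zero_less_power)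
  have "B (z b) (z b) \<le> B (z t) (z t)" if "t > b" for t
    using incr[of b t] b that by (smt (verit) mult_nonneg_nonneg zero_le_power2)
  then have "eventually (\<lambda>t. B (z b) (z b) \<le> B (z t) (z t)) at_top"
    by (rule eventually_mono[OF eventually_gt_at_top])
  from tendsto_lowerbound[OF lim this] Vb show False by simp
qed

section \<open>Time shares of periodic switching\<close>

text \<open>The number of full periods elapsed is the quotient by \<open>m\<close> of the number of
  full slots elapsed, so the index is governed by the remainder.\<close>

lemma switch_index_eq:
  assumes "m \<ge> 1" "\<tau> s > 0"
  shows "switch_index m \<tau> s = 1 + nat (\<lfloor>s / \<tau> s\<rfloor> mod int m)"
proof -
  define n where "n = \<lfloor>s / (real m * \<tau> s)\<rfloor>"
  have "n = \<lfloor>s / \<tau> s\<rfloor> div int m"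
    using floor_divide_real_eq_div[of "int m" "s / \<tau> s"] by (simp add: n_def mult.commute)
  moreover have "(s - real m * \<tau> s * of_int n) / \<tau> s = s / \<tau> s - of_int (int m * n)"
    using assms by (simp add: field_simps)
  ultimately show ?thesis
    unfolding switch_index_def n_def[symmetric]
    by (simp only: floor_diff_of_int minus_mult_div_eq_mod)
qed

text \<open>Indicator of the times at which subsystem \<open>Suc k\<close> is active under a
  constant switching time. It lives on the whole real line, so windows can be shifted to the left of
  0.\<close>

definition slot :: "nat \<Rightarrow> real \<Rightarrow> nat \<Rightarrow> real \<Rightarrow> real" where
  "slot m \<tau> k s = (if \<lfloor>s / \<tau>\<rfloor> mod int m = int k then 1 else 0)"

lemma slot_integrable_on: "slot m \<tau> k integrable_on {a..b}"
proof (rule measurable_bounded_by_integrable_imp_integrable)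
  have "slot m \<tau> k \<in> borel_measurable borel"
    unfolding slot_def by measurable
  then show "slot m \<tau> k \<in> borel_measurable (lebesgue_on {a..b})"
    by (intro measurable_restrict_space1 measurable_completion) simp
  show "(\<lambda>_. 1 :: real) integrable_on {a..b}" by (rule integrable_const_ivl)
qed (auto simp: slot_def)

lemma slot_integral_bounds:
  assumes "a \<le> b"
  shows "0 \<le> integral {a..b} (slot m \<tau> k)" "integral {a..b} (slot m \<tau> k) \<le> b - a"
proof -
  show "0 \<le> integral {a..b} (slot m \<tau> k)"
    by (rule integral_nonneg[OF slot_integrable_on]) (simp add: slot_def)
  have "integral {a..b} (slot m \<tau> k) \<le> integral {a..b} (\<lambda>_. 1)"
    by (rule integral_le[OF slot_integrable_on]) (auto simp: slot_def)
  then show "integral {a..b} (slot m \<tau> k) \<le> b - a" using assms by simp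
qed

lemma slot_shift:
  assumes "\<tau> > 0" "Suc k < m"
  shows "slot m \<tau> (Suc k) (s + \<tau>) = slot m \<tau> k s"
proof -
  define x where "x = \<lfloor>s / \<tau>\<rfloor>"
  have "(s + \<tau>) / \<tau> = s / \<tau> + 1" using assms by (simp add: field_simps)
  then have "\<lfloor>(s + \<tau>) / \<tau>\<rfloor> = x + 1" by (simp add: x_def)
  moreover have "(x + 1) mod int m = int (Suc k) \<longleftrightarrow> x mod int m = int k"
  proof
    assume "(x + 1) mod int m = int (Suc k)"
    then have "((x + 1) mod int m - 1) mod int m = int k mod int m" by simp
    then show "x mod int m = int k" using assms by (simp add: mod_diff_left_eq)
  next
    assume "x mod int m = int k"
    then have "(x mod int m + 1) mod int m = int (Suc k) mod int m" by (simp add: add.commute)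
    then show "(x + 1) mod int m = int (Suc k)" using assms by (simp add: mod_add_left_eq)
  qed
  ultimately show ?thesis by (simp add: slot_def x_def)
qed

text \<open>A shift by \<tau> turns one slot into the next and moves the window. The two windows
  differ by end pieces of length \<tau>, whose contributions lie between 0 and \<tau> and enter with
  opposite signs.\<close>

lemma slot_integral_step:
  assumes "\<tau> > 0" "Suc k < m" "a \<le> b"
  shows "\<bar>integral {a..b} (slot m \<tau> (Suc k)) - integral {a..b} (slot m \<tau> k)\<bar> \<le> \<tau>"
proof -
  let ?I = "\<lambda>a b. integral {a..b} (slot m \<tau> k)"
  have "integral {a..b} (slot m \<tau> (Suc k)) = ?I (a - \<tau>) (b - \<tau>)"
    using integral_shift_real_ivl[of a \<tau> b "slot m \<tau> (Suc k)"] slot_shift[OF assms(1,2)] by simp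
  moreover have "?I (a - \<tau>) a + ?I a b = ?I (a - \<tau>) b"
    using assms by (intro Henstock_Kurzweil_Integration.integral_combine slot_integrable_on) auto
  moreover have "?I (a - \<tau>) (b - \<tau>) + ?I (b - \<tau>) b = ?I (a - \<tau>) b"
    using assms by (intro Henstock_Kurzweil_Integration.integral_combine slot_integrable_on) auto
  moreover have "0 \<le> ?I (a - \<tau>) a" "?I (a - \<tau>) a \<le> \<tau>" "0 \<le> ?I (b - \<tau>) b" "?I (b - \<tau>) b \<le> \<tau>"
    using slot_integral_bounds[of "a - \<tau>" a m \<tau> k] slot_integral_bounds[of "b - \<tau>" b m \<tau> k] assms by auto
  ultimately show ?thesis by linarith
qed

lemma sum_slot:
  fixes v :: "nat \<Rightarrow> 'a::real_vector"
  assumes "m \<ge> 1"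
  shows "(\<Sum>k<m. slot m \<tau> k s *\<^sub>R v k) = v (nat (\<lfloor>s / \<tau>\<rfloor> mod int m))"
proof -
  let ?j = "nat (\<lfloor>s / \<tau>\<rfloor> mod int m)"
  have j: "int ?j = \<lfloor>s / \<tau>\<rfloor> mod int m" "?j < m"
    using assms by (auto simp: nat_less_iff)
  have k: "\<lfloor>s / \<tau>\<rfloor> mod int m = int k \<longleftrightarrow> k = ?j" for k
    using j(1) by (metis nat_int)
  have "(\<Sum>k<m. slot m \<tau> k s *\<^sub>R v k) = (\<Sum>k<m. if k = ?j then v k else 0)"
    by (rule sum.cong) (auto simp: slot_def k)
  then show ?thesis using j(2) by simp
qed

text \<open>Shifting time by \<open>\<tau>\<close> carries each slot to the next one, so all slots get nearly equal shares of any
  interval, and the shares add up to its length.\<close>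

lemma slot_integral_share:
  assumes "m \<ge> 1" "\<tau> > 0" "a \<le> b" "j < m"
  shows "\<bar>integral {a..b} (slot m \<tau> j) - (b - a) / real m\<bar> \<le> 2 * real m * \<tau>"
proof -
  define I where "I k = integral {a..b} (slot m \<tau> k)" for k
  \<comment> \<open>Each share is compared with that of slot 0, at a cost of \<tau> per
    step.\<close>
  have "\<bar>I k - I 0\<bar> \<le> real k * \<tau>" if "k < m" for k
    using that
  proof (induction k)
    case (Suc k)
    then have "\<bar>I (Suc k) - I k\<bar> \<le> \<tau>" unfolding I_def by (intro slot_integral_step assms) auto
    then show ?case using Suc by (simp add: algebra_simps)
  qed simp
  moreover have "real k * \<tau> \<le> real m * \<tau>" if "k < m" for k using assms that by simp
  ultimately have I0: "\<bar>I k - I 0\<bar> \<le> real m * \<tau>" if "k < m" for k using that by (meson order_trans)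
  have "(\<Sum>k<m. I k) = integral {a..b} (\<lambda>s. \<Sum>k<m. slot m \<tau> k s)"
    unfolding I_def by (simp add: integral_sum slot_integrable_on)
  also have "\<dots> = b - a"
    using assms sum_slot[of m \<tau> _ "\<lambda>_. 1 :: real"] by simp
  finally have "real m * I j - (b - a) = (\<Sum>k<m. I j - I k)"
    by (simp add: sum_subtractf)
  also have "\<bar>\<dots>\<bar> \<le> (\<Sum>k<m. 2 * real m * \<tau>)"
  proof (rule order_trans[OF sum_abs sum_mono])
    fix k assume "k \<in> {..<m}"
    then show "\<bar>I j - I k\<bar> \<le> 2 * real m * \<tau>" using I0[of k] I0[of j] assms by auto
  qed
  finally have "\<bar>real m * I j - (b - a)\<bar> \<le> real m * (2 * real m * \<tau>)" by simp
  moreover have "real m * I j - (b - a) = real m * (I j - (b - a) / real m)"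
    using assms by (simp add: field_simps)
  ultimately have "real m * \<bar>I j - (b - a) / real m\<bar> \<le> real m * (2 * real m * \<tau>)"
    by (simp add: abs_mult)
  then show ?thesis using assms by (simp add: I_def)
qed

section \<open>Decay under fast switching\<close>

text \<open>The abstract setting of the decay estimate, with \<open>P\<close> a Lyapunov form for
  the average of the \<open>h k\<close>. Since \<open>dissipation\<close> speaks of the sum, its
  rate carries the factor \<open>m\<close>.\<close>

locale switched_family =
  fixes m :: nat and h :: "nat \<Rightarrow> 'a::euclidean_space \<Rightarrow> 'a" and P :: "'a \<Rightarrow> 'a \<Rightarrow> real"
    and R L K c :: real
  assumes m: "m \<ge> 1" and pos: "R > 0" "L > 0" "K > 0" "c > 0"
    and lip: "\<And>k x y. k \<in> {1..m} \<Longrightarrow> norm x \<le> R \<Longrightarrow> norm y \<le> R \<Longrightarrow> norm (h k x - h k y) \<le> L * norm (x - y)"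
    and h0: "\<And>k. k \<in> {1..m} \<Longrightarrow> h k 0 = 0"
    and P: "bounded_bilinear P" and P_sym: "\<And>x y. P x y = P y x"
    and P_upper: "\<And>x y. \<bar>P x y\<bar> \<le> K * norm x * norm y"
    and P_lower: "\<And>x. c * (norm x)\<^sup>2 \<le> P x x"
    and dissipation: "\<And>x. norm x \<le> R \<Longrightarrow> 2 * P x (\<Sum>k=1..m. h k x) \<le> - real m * (norm x)\<^sup>2"
begin

interpretation P: bounded_bilinear P by (fact P)

definition cyclic_index :: "real \<Rightarrow> real \<Rightarrow> nat" where
  "cyclic_index \<tau> s = 1 + nat (\<lfloor>s / \<tau>\<rfloor> mod int m)"

lemma h_bound: "k \<in> {1..m} \<Longrightarrow> norm x \<le> R \<Longrightarrow> norm (h k x) \<le> L * norm x"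
  using lip[of k x 0] h0 pos by simp

text \<open>A Gronwall bound without exponentials: the drift is at most L (b - a) \<le> 1/2 times
  the maximum of |w| on the window, so at the maximum it can be absorbed.\<close>

lemma window_bound_if_confined:
  assumes cont: "continuous_on {a..b} w" and \<sigma>: "\<And>s. s \<in> {a..b} \<Longrightarrow> \<sigma> s \<in> {1..m}"
    and int: "\<And>s. s \<in> {a..b} \<Longrightarrow> ((\<lambda>r. h (\<sigma> r) (w r)) has_integral w s - w a) {a..s}"
    and small: "L * (b - a) \<le> 1 / 2" and conf: "\<And>s. s \<in> {a..b} \<Longrightarrow> norm (w s) \<le> R"
    and s: "s \<in> {a..b}"
  shows "norm (w s) \<le> 2 * norm (w a)"
proof -
  have "compact {a..b}" "{a..b} \<noteq> {}" using s by auto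
  then obtain q where q: "q \<in> {a..b}" "\<And>r. r \<in> {a..b} \<Longrightarrow> norm (w r) \<le> norm (w q)"
    using continuous_attains_sup[of "{a..b}" "\<lambda>r. norm (w r)"] continuous_on_norm[OF cont] by auto
  have "norm (w q - w a) \<le> L * norm (w q) * measure lborel {a..q}"
  proof (rule has_integral_bound_real[OF _ finite.emptyI int[OF q(1)]])
    fix r assume "r \<in> {a..q} - {}"
    then have r: "r \<in> {a..b}" using q by auto
    have "norm (h (\<sigma> r) (w r)) \<le> L * norm (w r)" by (rule h_bound[OF \<sigma>[OF r] conf[OF r]])
    also have "\<dots> \<le> L * norm (w q)" using q(2)[OF r] pos by simp
    finally show "norm (h (\<sigma> r) (w r)) \<le> L * norm (w q)" .
  qed (use pos in simp)
  also have "\<dots> \<le> L * norm (w q) * (b - a)"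
    using q pos by (intro mult_left_mono) auto
  also have "\<dots> = (L * (b - a)) * norm (w q)" by simp
  also have "\<dots> \<le> 1 / 2 * norm (w q)" using small by (intro mult_right_mono) auto
  finally have "norm (w q) \<le> 2 * norm (w a)"
    using norm_triangle_ineq2[of "w q" "w a"] by linarith
  then show ?thesis using q(2)[OF s] by simp
qed

text \<open>Confinement follows by continuation: up to a first time with |w| \<ge> R, the bound for
  confined solutions yields |w| \<le> R / 2, a contradiction.\<close>

lemma window_bound:
  assumes cont: "continuous_on {a..b} w" and \<sigma>: "\<And>s. s \<in> {a..b} \<Longrightarrow> \<sigma> s \<in> {1..m}"
    and int: "\<And>s. s \<in> {a..b} \<Longrightarrow> ((\<lambda>r. h (\<sigma> r) (w r)) has_integral w s - w a) {a..s}"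
    and small: "L * (b - a) \<le> 1 / 2" and start: "norm (w a) \<le> R / 4"
    and s: "s \<in> {a..b}"
  shows "norm (w s) \<le> 2 * norm (w a)"
proof -
  have "norm (w r) < R" if r: "r \<in> {a..b}" for r
  proof (rule ccontr)
    assume "\<not> norm (w r) < R"
    define X where "X = {a..b} \<inter> (\<lambda>s. norm (w s)) -` {R..}"
    have "closed X" unfolding X_def
      by (intro continuous_closed_preimage continuous_on_norm cont) auto
    moreover have "r \<in> X" using r \<open>\<not> norm (w r) < R\<close> by (auto simp: X_def)
    moreover have bdd: "bdd_below X" by (auto simp: X_def intro!: bdd_belowI[of _ a])
    ultimately have inX: "Inf X \<in> X" by (intro closed_contains_Inf) auto
    define q where "q = Inf X"
    have q: "q \<in> {a..b}" "norm (w q) \<ge> R" using inX by (auto simp: q_def X_def)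
    have less: "norm (w s) < R" if "s \<in> {a..<q}" for s
      using that q cInf_lower[OF _ bdd, of s] by (force simp: X_def q_def)
    have "a < q" using q start pos by (cases "a = q") auto
    \<comment> \<open>Continuity from the left extends the confinement to the exit time
      itself.\<close>
    have "norm (w q) \<le> R"
    proof (rule continuous_ge_on_closure[of "{a..<q}" "\<lambda>s. R - norm (w s)" q 0, simplified])
      show "continuous_on (closure {a..<q}) (\<lambda>s. R - norm (w s))"
        using \<open>a < q\<close> q by (auto intro!: continuous_intros continuous_on_subset[OF cont])
      show "q \<in> closure {a..<q}" using \<open>a < q\<close> by simp
    qed (use less in \<open>force\<close>)
    moreover have "L * (q - a) \<le> L * (b - a)" using q pos by (intro mult_left_mono) auto
    then have "L * (q - a) \<le> 1 / 2" using small by (rule order_trans)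
    ultimately have "norm (w q) \<le> 2 * norm (w a)"
      using less q by (intro window_bound_if_confined[of a q w \<sigma>] continuous_on_subset[OF cont] \<sigma> int)
        (auto simp: less_eq_real_def)
    then show False using q start pos by linarith
  qed
  then show ?thesis
    using window_bound_if_confined[OF cont \<sigma> int small _ s] by (force intro: less_imp_le)
qed

text \<open>Freezing the state at \<open>w a\<close> changes the displacement only to second order
  in the window length. This error and the quadratic term of \<open>P\<close> contribute 4 each to
  the coefficient 8; the unequal shares of the subsystems give the term in \<tau>.\<close>

lemma window_decay:
  assumes ab: "a \<le> b" and cont: "continuous_on {a..b} w" and \<sigma>: "\<And>s. s \<in> {a..b} \<Longrightarrow> \<sigma> s \<in> {1..m}"
    and int: "\<And>s. s \<in> {a..b} \<Longrightarrow> ((\<lambda>r. h (\<sigma> r) (w r)) has_integral w s - w a) {a..s}"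
    and small: "L * (b - a) \<le> 1 / 2" and start: "norm (w a) \<le> R / 4"
    and \<tau>: "\<tau> > 0" and cyc: "\<And>s. s \<in> {a..<b} \<Longrightarrow> \<sigma> s = cyclic_index \<tau> s"
  shows "P (w b) (w b) \<le> P (w a) (w a) +
     (- (b - a) + 8 * K * L\<^sup>2 * (b - a)\<^sup>2 + 4 * K * L * (real m)\<^sup>2 * \<tau>) * (norm (w a))\<^sup>2"
proof -
  define l where "l = b - a"
  define N where "N = norm (w a)"
  have l: "l \<ge> 0" using ab by (simp add: l_def)
  have N: "N \<ge> 0" "N \<le> R" using start pos by (auto simp: N_def)
  have bound: "norm (w s) \<le> 2 * N" if "s \<in> {a..b}" for s
    unfolding N_def by (rule window_bound[OF cont \<sigma> int small start that])
  have bR: "norm (w s) \<le> R" if "s \<in> {a..b}" for s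
    using bound[OF that] start pos unfolding N_def by linarith
  have drift: "norm (w s - w a) \<le> 2 * L * l * N" if s: "s \<in> {a..b}" for s
  proof -
    have "norm (w s - w a) \<le> L * (2 * N) * measure lborel {a..s}"
    proof (rule has_integral_bound_real[OF _ finite.emptyI int[OF s]])
      fix r assume "r \<in> {a..s} - {}"
      then have r: "r \<in> {a..b}" using s by auto
      have "norm (h (\<sigma> r) (w r)) \<le> L * norm (w r)" by (rule h_bound[OF \<sigma>[OF r] bR[OF r]])
      also have "\<dots> \<le> L * (2 * N)" using bound[OF r] pos by simp
      finally show "norm (h (\<sigma> r) (w r)) \<le> L * (2 * N)" .
    qed (use pos N in simp)
    also have "\<dots> \<le> L * (2 * N) * l"
      using s pos N by (intro mult_left_mono) (auto simp: l_def)
    finally show ?thesis by (simp add: mult_ac)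
  qed
  define I where "I k = integral {a..b} (slot m \<tau> k)" for k
  \<comment> \<open>The displacement over the window if every field were evaluated at
    \<open>w a\<close>.\<close>
  define D where "D = (\<Sum>k<m. I k *\<^sub>R h (Suc k) (w a))"
  have "((\<lambda>s. \<Sum>k<m. slot m \<tau> k s *\<^sub>R h (Suc k) (w a)) has_integral D) {a..b}"
    unfolding D_def I_def
    by (intro has_integral_sum has_integral_scaleR_left integrable_integral slot_integrable_on) auto
  \<comment> \<open>The cyclic formula is known only before \<open>b\<close>, where the switching
    time may change, so the endpoint is treated as a spike.\<close>
  then have intD: "((\<lambda>s. h (\<sigma> s) (w a)) has_integral D) {a..b}"
    by (rule has_integral_spike_finite[of "{b}", rotated 2])
       (use cyc in \<open>auto simp: sum_slot[OF m, of \<tau> _ "\<lambda>k. h (Suc k) (w a)"] cyclic_index_def\<close>)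
  have intw: "((\<lambda>s. h (\<sigma> s) (w s)) has_integral w b - w a) {a..b}" using int ab by simp
  define E where "E = w b - w a - D"
  have "norm E \<le> L * (2 * L * l * N) * measure lborel {a..b}"
  proof (rule has_integral_bound_real[OF _ finite.emptyI has_integral_diff[OF intw intD, folded E_def]])
    fix s assume "s \<in> {a..b} - {}"
    then have s: "s \<in> {a..b}" by simp
    have "norm (h (\<sigma> s) (w s) - h (\<sigma> s) (w a)) \<le> L * norm (w s - w a)"
      by (rule lip[OF \<sigma>[OF s] bR[OF s]]) (use N in \<open>simp add: N_def\<close>)
    also have "\<dots> \<le> L * (2 * L * l * N)" using drift[OF s] pos by simp
    finally show "norm (h (\<sigma> s) (w s) - h (\<sigma> s) (w a)) \<le> L * (2 * L * l * N)" .
  qed (use pos l N in simp)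
  then have E: "norm E \<le> 2 * L\<^sup>2 * l\<^sup>2 * N"
    using ab by (simp add: l_def power2_eq_square mult_ac)
  have "\<bar>P (w a) E\<bar> \<le> K * N * norm E" using P_upper[of "w a" E] by (simp add: N_def)
  also have "\<dots> \<le> K * N * (2 * L\<^sup>2 * l\<^sup>2 * N)" using E pos N by (intro mult_left_mono) auto
  finally have PE: "P (w a) E \<le> 2 * K * L\<^sup>2 * l\<^sup>2 * N\<^sup>2" by (simp add: power2_eq_square mult_ac)
  have nb: "norm (w b - w a) \<le> 2 * L * l * N" using drift[of b] ab by simp
  have "P (w b - w a) (w b - w a) \<le> K * norm (w b - w a) * norm (w b - w a)"
    using P_upper[of "w b - w a" "w b - w a"] by simp
  also have "\<dots> \<le> K * (2 * L * l * N) * (2 * L * l * N)"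
    using nb pos l N by (intro mult_mono) auto
  finally have PD: "P (w b - w a) (w b - w a) \<le> 4 * K * L\<^sup>2 * l\<^sup>2 * N\<^sup>2" by (simp add: power2_eq_square mult_ac)
  \<comment> \<open>Equal shares give l times the average field, on which \<open>dissipation\<close>
    acts; the deviations are bounded by \<open>slot_integral_share\<close>.\<close>
  have "D = (l / real m) *\<^sub>R (\<Sum>k<m. h (Suc k) (w a)) + (\<Sum>k<m. (I k - l / real m) *\<^sub>R h (Suc k) (w a))"
    by (simp add: D_def scaleR_sum_right sum.distrib[symmetric] scaleR_left_diff_distrib)
  then have "P (w a) D = l / real m * P (w a) (\<Sum>k<m. h (Suc k) (w a))
      + (\<Sum>k<m. (I k - l / real m) * P (w a) (h (Suc k) (w a)))"
    by (simp add: P.add_right P.scaleR_right P.sum_right)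
  moreover have "(\<Sum>k<m. h (Suc k) (w a)) = (\<Sum>k=1..m. h k (w a))"
    using sum.atLeast1_atMost_eq[of "\<lambda>k. h k (w a)" m] by simp
  then have "2 * P (w a) (\<Sum>k<m. h (Suc k) (w a)) \<le> - real m * N\<^sup>2"
    using dissipation[of "w a"] N by (simp add: N_def)
  then have "l / real m * (2 * P (w a) (\<Sum>k<m. h (Suc k) (w a))) \<le> l / real m * (- real m * N\<^sup>2)"
    using l by (intro mult_left_mono) auto
  then have "2 * (l / real m * P (w a) (\<Sum>k<m. h (Suc k) (w a))) \<le> - l * N\<^sup>2"
    using m by (simp add: mult_ac)
  moreover have "(\<Sum>k<m. (I k - l / real m) * P (w a) (h (Suc k) (w a))) \<le> (\<Sum>k<m. (2 * real m * \<tau>) * (K * L * N\<^sup>2))"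
  proof (rule sum_mono)
    fix k assume k: "k \<in> {..<m}"
    have "\<bar>P (w a) (h (Suc k) (w a))\<bar> \<le> K * N * norm (h (Suc k) (w a))"
      using P_upper[of "w a" "h (Suc k) (w a)"] by (simp add: N_def)
    also have "\<dots> \<le> K * N * (L * N)"
      using h_bound[of "Suc k" "w a"] k N pos by (intro mult_left_mono) (auto simp: N_def)
    finally have "\<bar>P (w a) (h (Suc k) (w a))\<bar> \<le> K * L * N\<^sup>2" by (simp add: power2_eq_square mult_ac)
    moreover have "\<bar>I k - l / real m\<bar> \<le> 2 * real m * \<tau>"
      using slot_integral_share[OF m \<tau> ab, of k] k by (simp add: I_def l_def)
    ultimately have "\<bar>(I k - l / real m) * P (w a) (h (Suc k) (w a))\<bar> \<le> (2 * real m * \<tau>) * (K * L * N\<^sup>2)"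
      unfolding abs_mult using \<tau> by (intro mult_mono) auto
    then show "(I k - l / real m) * P (w a) (h (Suc k) (w a)) \<le> (2 * real m * \<tau>) * (K * L * N\<^sup>2)" by linarith
  qed
  moreover have "(\<Sum>k<m. (2 * real m * \<tau>) * (K * L * N\<^sup>2)) = 2 * K * L * (real m)\<^sup>2 * \<tau> * N\<^sup>2"
    by (simp add: power2_eq_square mult_ac)
  ultimately have "2 * P (w a) D \<le> - l * N\<^sup>2 + 4 * K * L * (real m)\<^sup>2 * \<tau> * N\<^sup>2" by linarith
  moreover have "P (w b) (w b) = P (w a) (w a) + 2 * P (w a) (w b - w a) + P (w b - w a) (w b - w a)"
    by (simp add: P.diff_left P.diff_right P_sym[of "w b" "w a"])
  moreover have "P (w a) (w b - w a) = P (w a) D + P (w a) E"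
    by (simp add: E_def flip: P.add_right)
  ultimately have "P (w b) (w b) \<le> P (w a) (w a) + (- l * N\<^sup>2 + 8 * K * L\<^sup>2 * l\<^sup>2 * N\<^sup>2 + 4 * K * L * (real m)\<^sup>2 * \<tau> * N\<^sup>2)"
    using PE PD by linarith
  then show ?thesis by (simp add: l_def N_def algebra_simps)
qed

text \<open>Per window the bracket in \<open>window_decay\<close> is at most -l + l/4 + l/4 = -l/2,
  so the form contracts by 1 - l / (2 K). The factor 4 is the square of the growth bound 2 inside a
  window.\<close>

lemma decay:
  assumes l: "l > 0" "L * l \<le> 1 / 2" "8 * K * L\<^sup>2 * l \<le> 1 / 4" "l \<le> K"
    and \<tau>0: "4 * K * L * (real m)\<^sup>2 * \<tau>0 \<le> l / 4"
    and cont: "\<And>a b. 0 \<le> a \<Longrightarrow> continuous_on {a..b} w"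
    and int: "\<And>a b. 0 \<le> a \<Longrightarrow> a \<le> b \<Longrightarrow> ((\<lambda>r. h (\<sigma> r) (w r)) has_integral w b - w a) {a..b}"
    and \<sigma>: "\<And>s. s \<ge> 0 \<Longrightarrow> \<sigma> s \<in> {1..m}"
    and cyc: "\<And>j::nat. \<exists>\<tau>. 0 < \<tau> \<and> \<tau> \<le> \<tau>0 \<and>
       (\<forall>s\<in>{real j * l..<real (Suc j) * l}. \<sigma> s = cyclic_index \<tau> s)"
    and start: "K * (norm (w 0))\<^sup>2 \<le> c * (R / 4)\<^sup>2" and s: "s \<ge> 0"
  shows "c * (norm (w s))\<^sup>2 \<le> 4 * (K * (1 - l / (2 * K)) ^ nat \<lfloor>s / l\<rfloor> * (norm (w 0))\<^sup>2)"
proof -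
  define \<rho> where "\<rho> = 1 - l / (2 * K)"
  have \<rho>: "0 \<le> \<rho>" "\<rho> \<le> 1" using l pos by (auto simp: \<rho>_def field_simps)
  define V where "V x = P x x" for x
  \<comment> \<open>The contraction keeps the form below its initial bound, and this places every
    window start in the ball where the window estimates apply.\<close>
  have small: "norm x \<le> R / 4" if "V x \<le> K * (norm (w 0))\<^sup>2" for x
  proof -
    have "c * (norm x)\<^sup>2 \<le> c * (R / 4)\<^sup>2" using that start P_lower[of x] by (simp add: V_def)
    then have "(norm x)\<^sup>2 \<le> (R / 4)\<^sup>2" using pos by simp
    then show ?thesis using pos by (simp add: power2_le_iff_abs_le)
  qed
  have V: "V (w (real j * l)) \<le> K * \<rho> ^ j * (norm (w 0))\<^sup>2 \<and> norm (w (real j * l)) \<le> R / 4" for j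
  proof (induction j)
    case 0
    have "V (w 0) \<le> K * (norm (w 0))\<^sup>2"
      using P_upper[of "w 0" "w 0"] by (simp add: V_def power2_eq_square)
    then show ?case using small by simp
  next
    case (Suc j)
    let ?a = "real j * l" and ?b = "real (Suc j) * l"
    have ba: "?b - ?a = l" by (simp add: algebra_simps)
    have ab: "0 \<le> ?a" "?a \<le> ?b" using l by (auto simp: algebra_simps)
    have s0: "0 \<le> s" if "s \<in> {?a..?b}" for s
      using order_trans[OF ab(1), of s] that by simp
    obtain \<tau> where \<tau>: "0 < \<tau>" "\<tau> \<le> \<tau>0" "\<forall>s\<in>{?a..<?b}. \<sigma> s = cyclic_index \<tau> s" using cyc by blast
    have "V (w ?b) \<le> V (w ?a) + (- (?b - ?a) + 8 * K * L\<^sup>2 * (?b - ?a)\<^sup>2 + 4 * K * L * (real m)\<^sup>2 * \<tau>) * (norm (w ?a))\<^sup>2"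
      unfolding V_def
      by (rule window_decay[where \<sigma> = \<sigma>, OF ab(2) cont \<sigma>[OF s0] int _ _ \<tau>(1)])
         (use ab l Suc \<tau>(3) ba in auto)
    also have "\<dots> \<le> V (w ?a) + (- (l / 2)) * (norm (w ?a))\<^sup>2"
    proof -
      have "8 * K * L\<^sup>2 * l\<^sup>2 \<le> l / 4"
        using mult_right_mono[OF l(3), of l] l(1) by (simp add: power2_eq_square mult_ac)
      moreover have "4 * K * L * (real m)\<^sup>2 * \<tau> \<le> 4 * K * L * (real m)\<^sup>2 * \<tau>0"
        using \<tau> pos by (intro mult_left_mono) auto
      ultimately show ?thesis unfolding ba
        using \<tau>0 by (intro add_left_mono mult_right_mono) auto
    qed
    \<comment> \<open>The upper bound V \<le> K |w|^2 makes the decrease proportional to V.\<close>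
    also have "\<dots> \<le> V (w ?a) - l / 2 * (V (w ?a) / K)"
    proof -
      have "V (w ?a) \<le> K * (norm (w ?a))\<^sup>2"
        using P_upper[of "w ?a" "w ?a"] by (simp add: V_def power2_eq_square)
      then have "V (w ?a) / K \<le> (norm (w ?a))\<^sup>2" using pos by (simp add: field_simps)
      then have "l / 2 * (V (w ?a) / K) \<le> l / 2 * (norm (w ?a))\<^sup>2" using l by (intro mult_left_mono) auto
      then show ?thesis by simp
    qed
    also have "\<dots> = \<rho> * V (w ?a)" using pos by (simp add: \<rho>_def field_simps)
    also have "\<dots> \<le> \<rho> * (K * \<rho> ^ j * (norm (w 0))\<^sup>2)" using Suc \<rho> by (intro mult_left_mono) auto
    finally have 1: "V (w ?b) \<le> K * \<rho> ^ Suc j * (norm (w 0))\<^sup>2" by (simp add: mult_ac)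
    have "\<rho> ^ Suc j \<le> 1" using \<rho> by (rule power_le_one)
    then have "K * \<rho> ^ Suc j * (norm (w 0))\<^sup>2 \<le> K * 1 * (norm (w 0))\<^sup>2"
      using pos by (intro mult_right_mono mult_left_mono) auto
    then show ?case using 1 small[of "w ?b"] by simp
  qed
  define j where "j = nat \<lfloor>s / l\<rfloor>"
  have "real j \<le> s / l" "s / l < real j + 1" using s l by (auto simp: j_def)
  then have sj: "s \<in> {real j * l..real (Suc j) * l}" using l by (auto simp: field_simps)
  have aj: "0 \<le> real j * l" using l by simp
  have s0: "0 \<le> s'" if "s' \<in> {real j * l..real (Suc j) * l}" for s'
    using order_trans[OF aj, of s'] that by simp
  have "norm (w s) \<le> 2 * norm (w (real j * l))"
    by (rule window_bound[where \<sigma> = \<sigma>, OF cont[OF aj] \<sigma>[OF s0] int[OF aj] _ _ sj])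
       (use l V[of j] in \<open>auto simp: algebra_simps\<close>)
  then have "(norm (w s))\<^sup>2 \<le> (2 * norm (w (real j * l)))\<^sup>2" by (intro power_mono) auto
  then have "c * (norm (w s))\<^sup>2 \<le> c * (2 * norm (w (real j * l)))\<^sup>2" using pos by simp
  also have "\<dots> \<le> 4 * V (w (real j * l))" using P_lower[of "w (real j * l)"] by (simp add: V_def)
  also have "\<dots> \<le> 4 * (K * \<rho> ^ j * (norm (w 0))\<^sup>2)" using V[of j] by simp
  finally show ?thesis by (simp add: j_def \<rho>_def)
qed

end

section \<open>Concrete switching times and windows aligned with the periods\<close>

text \<open>On the n-th period the value is \<tau>0 / n, a witness that starts at the prescribed
  bound.\<close>

lemma switching_time_harmonic:
  assumes T: "T > 0" and "\<tau>0 > 0"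
  shows "switching_time T (\<lambda>s. \<tau>0 / (1 + of_int \<lfloor>s / T\<rfloor>))"
  unfolding switching_time_def
proof (intro conjI allI impI)
  show "0 < \<tau>0 / (1 + of_int \<lfloor>s / T\<rfloor>)" if "s \<ge> 0" for s
    using assms that by (intro divide_pos_pos add_pos_nonneg) auto
  show "antimono_on {0..} (\<lambda>s. \<tau>0 / (1 + of_int \<lfloor>s / T\<rfloor>))"
  proof (rule monotone_onI)
    fix r s :: real assume rs: "r \<in> {0..}" "s \<in> {0..}" "r \<le> s"
    then have "\<lfloor>r / T\<rfloor> \<le> \<lfloor>s / T\<rfloor>" using T by (intro floor_mono divide_right_mono) auto
    moreover have "0 \<le> \<lfloor>r / T\<rfloor>" using rs T by simp
    ultimately show "\<tau>0 / (1 + of_int \<lfloor>s / T\<rfloor>) \<le> \<tau>0 / (1 + of_int \<lfloor>r / T\<rfloor>)"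
      using assms by (intro divide_left_mono mult_pos_pos add_pos_nonneg add_left_mono) (auto simp del: zero_le_floor)
  qed
  show "((\<lambda>s. \<tau>0 / (1 + of_int \<lfloor>s / T\<rfloor>)) \<longlongrightarrow> 0) at_top"
  proof (rule tendsto_sandwich[where f = "\<lambda>_. 0" and h = "\<lambda>s. \<tau>0 * T / s"])
    show "\<forall>\<^sub>F s in at_top. 0 \<le> \<tau>0 / (1 + of_int \<lfloor>s / T\<rfloor>)"
      using eventually_ge_at_top[of 0] by eventually_elim (use assms in simp)
    show "\<forall>\<^sub>F s in at_top. \<tau>0 / (1 + of_int \<lfloor>s / T\<rfloor>) \<le> \<tau>0 * T / s"
      using eventually_gt_at_top[of 0]
    proof eventually_elim
      case (elim s)
      have "s / T \<le> 1 + of_int \<lfloor>s / T\<rfloor>" by linarith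
      then have "\<tau>0 / (1 + of_int \<lfloor>s / T\<rfloor>) \<le> \<tau>0 / (s / T)"
        using assms elim by (intro divide_left_mono mult_pos_pos add_pos_nonneg) auto
      then show ?case by simp
    qed
    show "((\<lambda>s. \<tau>0 * T / s) \<longlongrightarrow> 0) at_top"
      by (rule tendsto_divide_0[OF tendsto_const]) (simp add: filterlim_at_top_imp_at_infinity filterlim_ident)
  qed simp
  show "(\<lambda>s. \<tau>0 / (1 + of_int \<lfloor>s / T\<rfloor>)) constant_on {(real n - 1) * T..<real n * T}" for n
    unfolding constant_on_def
  proof (intro exI ballI)
    fix s assume s: "s \<in> {(real n - 1) * T..<real n * T}"
    have "of_int (int n - 1) \<le> s / T" "s / T < of_int (int n - 1) + 1"
      using s T by (auto simp: field_simps)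
    then have "\<lfloor>s / T\<rfloor> = int n - 1" by (rule floor_unique)
    then show "\<tau>0 / (1 + of_int \<lfloor>s / T\<rfloor>) = \<tau>0 / (1 + of_int (int n - 1))" by simp
  qed
qed

text \<open>Windows of length T / N refine the periods: window \<open>j\<close> lies in period
  \<open>j div N + 1\<close>, counted from 1.\<close>

lemma switching_time_constant_on_window:
  assumes \<tau>: "switching_time T \<tau>" and T: "T > 0" and N: "N \<ge> 1"
  shows "\<tau> constant_on {real j * (T / real N)..<real (Suc j) * (T / real N)}"
proof -
  define n where "n = j div N + 1"
  have "\<forall>n::nat. n \<ge> 1 \<longrightarrow> \<tau> constant_on {(real n - 1) * T..<real n * T}"
    using \<tau> unfolding switching_time_def by (elim conjE)
  moreover have "n \<ge> 1" by (simp add: n_def)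
  ultimately have "\<tau> constant_on {(real n - 1) * T..<real n * T}" by blast
  moreover have "{real j * (T / real N)..<real (Suc j) * (T / real N)} \<subseteq> {(real n - 1) * T..<real n * T}"
  proof -
    have "(j div N) * N \<le> j" by simp
    then have "real (j div N) * real N \<le> real j" by (metis of_nat_le_iff of_nat_mult)
    then have 1: "real (j div N) * T \<le> real j * (T / real N)"
      using N T by (simp add: field_simps)
    have "Suc j \<le> n * N" using N dividend_less_div_times[of N j] by (simp add: n_def)
    then have "real (Suc j) \<le> real n * real N" by (metis of_nat_le_iff of_nat_mult)
    then have "real (Suc j) * (T / real N) \<le> (real n * real N) * (T / real N)"
      using T by (intro mult_right_mono) auto
    then have 2: "real (Suc j) * (T / real N) \<le> real n * T" using N by simp
    show ?thesis using 1 2 by (auto simp: n_def)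
  qed
  ultimately show ?thesis by (rule constant_on_subset)
qed

context switched_family
begin

text \<open>The right-hand side depends on time only through \<open>t - t0\<close>, so shifting the
  start to 0 reduces to \<open>decay\<close> and makes the estimate uniform in
  \<open>t0\<close>.\<close>

lemma solution_decay:
  assumes G: "\<And>t x. G t x = h (switch_index m \<tau> (t - t0)) x"
    and \<tau>: "switching_time T \<tau>" "\<And>s. s \<ge> 0 \<Longrightarrow> \<tau> s \<le> \<tau>0"
    and T: "T > 0" and N: "N \<ge> 1" "l = T / real N"
    and l: "L * l \<le> 1 / 2" "8 * K * L\<^sup>2 * l \<le> 1 / 4" "l \<le> K"
    and \<tau>0: "4 * K * L * (real m)\<^sup>2 * \<tau>0 \<le> l / 4"
    and sol: "caratheodory_solution G t0 x0 z"
    and start: "K * (norm x0)\<^sup>2 \<le> c * (R / 4)\<^sup>2" and t: "t \<ge> t0"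
  shows "c * (norm (z t))\<^sup>2 \<le> 4 * (K * (1 - l / (2 * K)) ^ nat \<lfloor>(t - t0) / l\<rfloor> * (norm x0)\<^sup>2)"
proof -
  define w where "w s = z (s + t0)" for s
  have l0: "l > 0" using N T by simp
  have w0: "w 0 = x0" using sol by (simp add: w_def caratheodory_solution_def)
  have pos\<tau>: "s \<ge> 0 \<Longrightarrow> \<tau> s > 0" for s using \<tau>(1) by (simp add: switching_time_def)
  have "c * (norm (w (t - t0)))\<^sup>2 \<le> 4 * (K * (1 - l / (2 * K)) ^ nat \<lfloor>(t - t0) / l\<rfloor> * (norm (w 0))\<^sup>2)"
  proof (rule decay[where \<sigma> = "switch_index m \<tau>", OF l0 l \<tau>0])
    fix a b :: real assume a: "0 \<le> a"
    have "continuous_on {a + t0..b + t0} z"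
      by (rule caratheodory_solution_continuous_on[OF sol]) (use a in simp)
    then show "continuous_on {a..b} w"
      unfolding w_def by (rule continuous_on_compose2) (auto intro!: continuous_intros)
    assume "a \<le> b"
    then have "((\<lambda>r. G r (z r)) has_integral (z (b + t0) - z (a + t0))) {a + t0..b + t0}"
      by (intro caratheodory_solution_has_integral[OF sol]) (use a in auto)
    from has_integral_shift_real_ivl[OF this, of t0]
    show "((\<lambda>r. h (switch_index m \<tau> r) (w r)) has_integral w b - w a) {a..b}"
      by (simp add: G w_def)
  next
    fix s :: real assume "s \<ge> 0"
    then show "switch_index m \<tau> s \<in> {1..m}" using switch_index_int(2) m pos\<tau> by blast
  next
    fix j :: nat
    obtain \<theta> where \<theta>: "\<And>s. s \<in> {real j * l..<real (Suc j) * l} \<Longrightarrow> \<tau> s = \<theta>"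
      using switching_time_constant_on_window[OF \<tau>(1) T N(1), of j] N(2)
      by (auto simp: constant_on_def)
    have *: "0 \<le> s" if "s \<in> {real j * l..<real (Suc j) * l}" for s
      using that l0 by (auto intro: order_trans[rotated])
    \<comment> \<open>The window is nonempty, so its constant value inherits positivity and the
      upper bound.\<close>
    have "real j * l \<in> {real j * l..<real (Suc j) * l}" using l0 by (simp add: algebra_simps)
    then have "0 < \<theta>" "\<theta> \<le> \<tau>0" using \<theta> * pos\<tau> \<tau>(2) by (metis, metis)
    moreover have "switch_index m \<tau> s = cyclic_index \<theta> s" if "s \<in> {real j * l..<real (Suc j) * l}" for s
      using switch_index_eq[of m \<tau> s, OF m pos\<tau>[OF *[OF that]]] \<theta>[OF that] by (simp add: cyclic_index_def)
    ultimately show "\<exists>\<tau>'. 0 < \<tau>' \<and> \<tau>' \<le> \<tau>0 \<and>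
        (\<forall>s\<in>{real j * l..<real (Suc j) * l}. switch_index m \<tau> s = cyclic_index \<tau>' s)" by blast
  qed (use start t w0 in auto)
  then show ?thesis by (simp add: w0) (simp add: w_def)
qed

text \<open>The decay estimate holds for every switching time below \<tau>0 with the same rate,
  hence for all that dominate \<tau>'.\<close>

lemma exists_uniform_switching_time:
  fixes G :: "(real \<Rightarrow> real) \<Rightarrow> real \<Rightarrow> real \<Rightarrow> 'a \<Rightarrow> 'a"
  assumes G: "\<And>\<tau> t0 t x. G \<tau> t0 t x = h (switch_index m \<tau> (t - t0)) x"
    and T: "T > 0" and \<epsilon>: "\<epsilon> > 0"
  shows "\<exists>\<delta> \<tau>'. \<delta> > 0 \<and> switching_time T \<tau>' \<and>
       (\<forall>\<tau>. switching_time T \<tau> \<and> dominates \<tau> \<tau>' \<longrightarrow>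
          uniformly_confined G \<delta> \<tau> \<epsilon> \<and> uniformly_attracted G \<delta> \<tau>)"
proof -
  \<comment> \<open>The three smallness conditions of \<open>decay\<close> on the window
    length.\<close>
  define l0 where "l0 = min (1 / (2 * L)) (min (1 / (32 * K * L\<^sup>2)) K)"
  have l0: "l0 > 0" using pos by (simp add: l0_def)
  obtain N :: nat where N: "T / l0 < real N" using reals_Archimedean2 by blast
  moreover have "0 < T / l0" using T l0 by simp
  ultimately have N1: "N \<ge> 1" by (cases N) auto
  \<comment> \<open>A length below \<open>l0\<close> that divides \<open>T\<close>.\<close>
  define l where "l = T / real N"
  have l: "l > 0" "l \<le> l0" using N N1 T l0 by (auto simp: l_def field_simps)
  then have "l \<le> 1 / (2 * L)" "l \<le> 1 / (32 * K * L\<^sup>2)" and lK: "l \<le> K" by (auto simp: l0_def)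
  then have l12: "L * l \<le> 1 / 2" "8 * K * L\<^sup>2 * l \<le> 1 / 4"
    using pos by (auto simp: field_simps)
  \<comment> \<open>Solves 4 K L m^2 \<tau>0 = l / 4.\<close>
  define \<tau>0 where "\<tau>0 = l / (16 * K * L * (real m)\<^sup>2)"
  have \<tau>0: "\<tau>0 > 0" "4 * K * L * (real m)\<^sup>2 * \<tau>0 \<le> l / 4"
    using l pos m by (auto simp: \<tau>0_def field_simps)
  define \<tau>' where "\<tau>' s = \<tau>0 / (1 + of_int \<lfloor>s / T\<rfloor>)" for s
  have \<tau>': "switching_time T \<tau>'"
    using switching_time_harmonic[OF T \<tau>0(1)] by (simp add: \<tau>'_def[abs_def])
  have \<tau>'_le: "\<tau>' s \<le> \<tau>0" if "s \<ge> 0" for s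
    using divide_left_mono[of 1 "1 + of_int \<lfloor>s / T\<rfloor>" \<tau>0] \<tau>0(1) T that by (simp add: \<tau>'_def add_pos_nonneg)
  \<comment> \<open>The bound R / 4 makes the start admissible; the factor 2 lost inside windows
    leaves solutions below 2 q \<le> \<epsilon> / 2.\<close>
  define q where "q = min R \<epsilon> / 4"
  have q: "q > 0" "q \<le> R / 4" "q \<le> \<epsilon> / 4" using pos \<epsilon> by (auto simp: q_def)
  \<comment> \<open>Chosen so that K \<delta>^2 = c q^2, which passes from the norm to the form and
    back.\<close>
  define \<delta> where "\<delta> = q * sqrt (c / K)"
  have \<delta>: "\<delta> > 0" "K * \<delta>\<^sup>2 = c * q\<^sup>2" using q pos by (auto simp: \<delta>_def power_mult_distrib)
  define \<rho> where "\<rho> = 1 - l / (2 * K)"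
  have \<rho>: "0 \<le> \<rho>" "\<rho> < 1" using l lK pos by (auto simp: \<rho>_def field_simps)
  have est: "(norm (z t))\<^sup>2 \<le> 4 * \<rho> ^ nat \<lfloor>(t - t0) / l\<rfloor> * q\<^sup>2"
    if \<tau>: "switching_time T \<tau>" "dominates \<tau> \<tau>'"
      and sol: "caratheodory_solution (G \<tau> t0) t0 x0 z" and x0: "norm x0 \<le> \<delta>" and t: "t \<ge> t0"
    for \<tau> t0 x0 z t
  proof -
    have "(norm x0)\<^sup>2 \<le> \<delta>\<^sup>2" using x0 by (intro power_mono) auto
    then have Kx: "K * (norm x0)\<^sup>2 \<le> c * q\<^sup>2" using pos by (simp flip: \<delta>(2))
    have "c * (norm (z t))\<^sup>2 \<le> 4 * (K * \<rho> ^ nat \<lfloor>(t - t0) / l\<rfloor> * (norm x0)\<^sup>2)"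
      unfolding \<rho>_def
    proof (rule solution_decay[OF G \<tau>(1) _ T N1 l_def l12 lK \<tau>0(2) sol _ t])
      show "\<tau> s \<le> \<tau>0" if "s \<ge> 0" for s
        using \<tau>(2) \<tau>'_le[OF that] that unfolding dominates_def by (meson order_trans)
      have "c * q\<^sup>2 \<le> c * (R / 4)\<^sup>2" using q pos by (intro mult_left_mono power_mono) auto
      then show "K * (norm x0)\<^sup>2 \<le> c * (R / 4)\<^sup>2" using Kx by linarith
    qed
    also have "\<dots> = 4 * \<rho> ^ nat \<lfloor>(t - t0) / l\<rfloor> * (K * (norm x0)\<^sup>2)" by simp
    also have "\<dots> \<le> 4 * \<rho> ^ nat \<lfloor>(t - t0) / l\<rfloor> * (c * q\<^sup>2)"
      using Kx \<rho> by (intro mult_left_mono) auto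
    also have "\<dots> = c * (4 * \<rho> ^ nat \<lfloor>(t - t0) / l\<rfloor> * q\<^sup>2)" by simp
    finally show ?thesis using pos by simp
  qed
  have "uniformly_confined G \<delta> \<tau> \<epsilon>" if \<tau>: "switching_time T \<tau>" "dominates \<tau> \<tau>'" for \<tau>
    unfolding uniformly_confined_def
  proof (intro allI impI)
    fix t0 x0 z t assume *: "caratheodory_solution (G \<tau> t0) t0 x0 z" "norm x0 \<le> \<delta>" "t0 \<le> t"
    have "(norm (z t))\<^sup>2 \<le> 4 * \<rho> ^ nat \<lfloor>(t - t0) / l\<rfloor> * q\<^sup>2" by (rule est[OF \<tau> *])
    also have "\<dots> \<le> 4 * 1 * q\<^sup>2" using \<rho> by (intro mult_right_mono mult_left_mono power_le_one) auto
    also have "\<dots> = (2 * q)\<^sup>2" by (simp add: power_mult_distrib)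
    finally have "norm (z t) \<le> 2 * q" by (rule power2_le_imp_le) (use q in simp)
    then show "norm (z t) \<le> \<epsilon>" using q \<epsilon> by linarith
  qed
  moreover have "uniformly_attracted G \<delta> \<tau>" if \<tau>: "switching_time T \<tau>" "dominates \<tau> \<tau>'" for \<tau>
    unfolding uniformly_attracted_def
  proof (intro allI impI)
    fix \<eta> :: real assume \<eta>: "\<eta> > 0"
    then obtain n where n: "\<rho> ^ n < \<eta>\<^sup>2 / (4 * q\<^sup>2)"
      using real_arch_pow_inv[of "\<eta>\<^sup>2 / (4 * q\<^sup>2)" \<rho>] q \<rho> by auto
    \<comment> \<open>A waiting time of \<open>n\<close> windows gives the decay;
      \<open>Suc n\<close> keeps it positive when \<open>n = 0\<close>.\<close>
    have "norm (z t) \<le> \<eta>" if *: "caratheodory_solution (G \<tau> t0) t0 x0 z" "norm x0 \<le> \<delta>" "t0 + real (Suc n) * l \<le> t"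
      for t0 x0 z t
    proof -
      have "0 < real (Suc n) * l" using l by simp
      then have t: "t0 \<le> t" using *(3) by linarith
      have "real n * l \<le> real (Suc n) * l" using l by simp
      then have "real n * l \<le> t - t0" using *(3) by linarith
      then have "real n \<le> (t - t0) / l" using l by (simp add: field_simps)
      then have "n \<le> nat \<lfloor>(t - t0) / l\<rfloor>" by (simp add: le_nat_iff le_floor_iff)
      then have "\<rho> ^ nat \<lfloor>(t - t0) / l\<rfloor> \<le> \<rho> ^ n" using \<rho> by (intro power_decreasing) auto
      then have "4 * \<rho> ^ nat \<lfloor>(t - t0) / l\<rfloor> * q\<^sup>2 \<le> 4 * \<rho> ^ n * q\<^sup>2" by (intro mult_right_mono mult_left_mono) auto
      also have "\<dots> \<le> \<eta>\<^sup>2" using n q by (simp add: field_simps)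
      finally have "(norm (z t))\<^sup>2 \<le> \<eta>\<^sup>2" using est[OF \<tau> *(1,2) t] by linarith
      then show ?thesis by (rule power2_le_imp_le) (use \<eta> in simp)
    qed
    then show "\<exists>T'>0. \<forall>t0\<ge>0. \<forall>x0 z. caratheodory_solution (G \<tau> t0) t0 x0 z \<longrightarrow>
        norm x0 \<le> \<delta> \<longrightarrow> (\<forall>t\<ge>t0 + T'. norm (z t) \<le> \<eta>)"
      using l by (intro exI[of _ "real (Suc n) * l"]) auto
  qed
  ultimately show ?thesis using \<delta>(1) \<tau>' by blast
qed

end

section \<open>A common Lipschitz constant for the subsystems\<close>

lemma finite_family_lipschitz:
  fixes h :: "'i \<Rightarrow> 'a::metric_space \<Rightarrow> 'b::metric_space"
  assumes "finite S" and "\<And>k. k \<in> S \<Longrightarrow> \<exists>u>0. \<exists>L. L-lipschitz_on (cball p u) (h k)"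
  shows "\<exists>u>0. \<exists>L>0. \<forall>k\<in>S. L-lipschitz_on (cball p u) (h k)"
  using assms
proof (induction S rule: finite_induct)
  case empty
  show ?case by (intro exI[of _ "1::real"] conjI) auto
next
  case (insert k S)
  then obtain u L where u: "u > 0" "L > 0" "\<forall>k\<in>S. L-lipschitz_on (cball p u) (h k)" by auto
  obtain u' L' where u': "u' > 0" "L'-lipschitz_on (cball p u') (h k)" using insert.prems[of k] by blast
  have "(max L L')-lipschitz_on (cball p (min u u')) (h j)" if "j \<in> insert k S" for j
  proof (cases "j = k")
    case True
    show ?thesis unfolding True by (rule lipschitz_on_le[OF lipschitz_on_subset[OF u'(2)]]) auto
  next
    case False
    then have "L-lipschitz_on (cball p u) (h j)" using that u(3) by auto
    then show ?thesis by (rule lipschitz_on_le[OF lipschitz_on_subset]) auto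
  qed
  then show ?case using u u' by (intro exI[of _ "min u u'"] conjI exI[of _ "max L L'"]) auto
qed

lemma scheduled_field_eq:
  "scheduled_field m f g \<kappa> \<tau> t0 t x =
     f x + real m *\<^sub>R (\<kappa> (switch_index m \<tau> (t - t0)) x *\<^sub>R g (switch_index m \<tau> (t - t0)) x)"
  by (simp add: scheduled_field_def Let_def)

text \<open>With the switching time \<open>T / m\<close> on the first period, every index is active at some time, so the
  Lipschitz condition on one scheduled system covers all the subsystems.\<close>

lemma subsystem_lipschitz:
  fixes f :: "real^'d \<Rightarrow> real^'d"
  assumes T: "T > 0" and k: "k \<in> {1..m}"
    and wp: "\<And>\<tau> t0. switching_time T \<tau> \<Longrightarrow> t0 \<ge> 0 \<Longrightarrow>
          well_posed (scheduled_field m f g \<kappa> \<tau> t0) t0"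
  shows "\<exists>u>0. \<exists>L. L-lipschitz_on (cball 0 u) (\<lambda>x. f x + real m *\<^sub>R (\<kappa> k x *\<^sub>R g k x))"
proof -
  have m: "m \<ge> 1" using k by simp
  \<comment> \<open>Exactly \<open>m\<close> slots of this length fill the first period, and index
    \<open>k\<close> takes over at time (k - 1) \<theta>.\<close>
  define \<theta> where "\<theta> = T / real m"
  define \<tau> where "\<tau> s = \<theta> / (1 + of_int \<lfloor>s / T\<rfloor>)" for s
  have \<theta>: "\<theta> > 0" using T m by (simp add: \<theta>_def)
  then have \<tau>: "switching_time T \<tau>"
    using switching_time_harmonic[OF T \<theta>] by (simp add: \<tau>_def[abs_def])
  define s where "s = real (k - 1) * \<theta>"
  have "s \<ge> 0" using \<theta> by (simp add: s_def)
  have "real (k - 1) < real m" using k by auto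
  then have "s < T" using T m by (simp add: s_def \<theta>_def field_simps)
  then have "\<lfloor>s / T\<rfloor> = 0" using T \<open>s \<ge> 0\<close> by (intro floor_unique) auto
  then have \<tau>s: "\<tau> s = \<theta>" by (simp add: \<tau>_def)
  have "s / \<theta> = of_int (int (k - 1))" using \<theta> by (simp add: s_def)
  then have "\<lfloor>s / \<theta>\<rfloor> = int (k - 1)" by (simp only: floor_of_int)
  moreover have "int (k - 1) mod int m = int (k - 1)" using k by (intro mod_pos_pos_trivial) auto
  ultimately have "switch_index m \<tau> s = k"
    using switch_index_eq[of m \<tau> s] m \<theta> k by (simp add: \<tau>s)
  moreover have "local_lipschitz {0..} UNIV (scheduled_field m f g \<kappa> \<tau> 0)"
    using wp[OF \<tau>, of 0] by (simp add: well_posed_def)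
  then obtain u L where "u > 0" "\<forall>t\<in>cball s u \<inter> {0..}. L-lipschitz_on (cball 0 u \<inter> UNIV) (scheduled_field m f g \<kappa> \<tau> 0 t)"
    using \<open>s \<ge> 0\<close> unfolding local_lipschitz_def by (meson UNIV_I atLeast_iff)
  moreover from this have "L-lipschitz_on (cball 0 u) (scheduled_field m f g \<kappa> \<tau> 0 s)"
    using \<open>s \<ge> 0\<close> by auto
  ultimately show ?thesis
    by (auto simp: scheduled_field_eq[abs_def])
qed

theorem theorem2p5:
  fixes m :: nat
    and f :: "real^'d \<Rightarrow> real^'d"
    and g :: "nat \<Rightarrow> real^'d \<Rightarrow> real^'d"
    and \<kappa> :: "nat \<Rightarrow> real^'d \<Rightarrow> real"
    and T :: real
  assumes m: "m \<ge> 1"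
    and f_C1: "C1_on f UNIV"
    and g_C1: "\<And>k. k \<in> {1..m} \<Longrightarrow> C1_on (g k) UNIV"
    and nominal_wp: "\<And>t0. t0 \<ge> 0 \<Longrightarrow> well_posed (\<lambda>_. nominal_field m f g \<kappa>) t0"
    and hyperbolic: "hyperbolic_equilibrium (nominal_field m f g \<kappa>) 0"
    and stable: "locally_asymptotically_stable (nominal_field m f g \<kappa>)"
    and C2: "\<exists>U. open U \<and> 0 \<in> U \<and> C2_on (nominal_field m f g \<kappa>) U"
    and f0: "f 0 = 0"
    and \<kappa>0: "\<And>k. k \<in> {1..m} \<Longrightarrow> \<kappa> k 0 = 0"
    and T: "T > 0"
    and scheduled_wp: "\<And>\<tau> t0. switching_time T \<tau> \<Longrightarrow> t0 \<ge> 0 \<Longrightarrow>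
          well_posed (scheduled_field m f g \<kappa> \<tau> t0) t0"
  shows "uniformly_asymptotically_stable T (scheduled_field m f g \<kappa>) \<and>
    (\<forall>\<epsilon>>0. \<exists>\<delta> \<tau>'. \<delta> > 0 \<and> switching_time T \<tau>' \<and>
       (\<forall>\<tau>. switching_time T \<tau> \<and> dominates \<tau> \<tau>' \<longrightarrow>
          uniformly_confined (scheduled_field m f g \<kappa>) \<delta> \<tau> \<epsilon> \<and>
          uniformly_attracted (scheduled_field m f g \<kappa>) \<delta> \<tau>))"
proof -
  define F where "F = nominal_field m f g \<kappa>"
  define h where "h k x = f x + real m *\<^sub>R (\<kappa> k x *\<^sub>R g k x)" for k x
  define G where "G = scheduled_field m f g \<kappa>"
  have G: "G \<tau> t0 t x = h (switch_index m \<tau> (t - t0)) x" for \<tau> t0 t x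
    by (simp add: G_def h_def scheduled_field_eq)
  have h0: "h k 0 = 0" if "k \<in> {1..m}" for k using f0 \<kappa>0[OF that] by (simp add: h_def)
  \<comment> \<open>The factor \<open>m\<close> in each subsystem makes their average the nominal
    field.\<close>
  have sum_h: "(\<Sum>k=1..m. h k x) = real m *\<^sub>R F x" for x
    by (simp add: h_def F_def nominal_field_def sum.distrib scaleR_sum_right scaleR_right_distrib sum_constant_scaleR del: sum_constant)
  have F0: "F 0 = 0" using hyperbolic by (simp add: hyperbolic_equilibrium_def F_def)
  obtain u L where u: "u > 0" "L > 0" and lip: "\<And>k. k \<in> {1..m} \<Longrightarrow> L-lipschitz_on (cball 0 u) (h k)"
    using finite_family_lipschitz[of "{1..m}" 0 h] subsystem_lipschitz[OF T _ scheduled_wp]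
    unfolding h_def[abs_def] by auto
  define A where "A = jacobian F (at 0)"
  have FA: "(F has_derivative (\<lambda>x. A *v x)) (at 0)"
    using hyperbolic unfolding hyperbolic_equilibrium_def A_def F_def jacobian_works by simp
  obtain B where B: "bounded_bilinear B" "\<And>x y. B x y = B y x" "\<And>x. (norm x)\<^sup>2 \<le> B x (A *v x)"
    using exists_lyapunov_form[of A] hyperbolic unfolding hyperbolic_equilibrium_def A_def F_def by blast
  interpret B: bounded_bilinear B by fact
  obtain r where r: "r > 0" "\<And>x. norm x \<le> r \<Longrightarrow> (norm x)\<^sup>2 / 2 \<le> B x (F x)"
    using dissipation_near_equilibrium[OF FA F0 B(1,3)] by blast
  \<comment> \<open>Within this radius both the Lipschitz bounds and the dissipation inequality
    hold.\<close>
  define R where "R = min r u"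
  have R: "R > 0" "R \<le> r" "R \<le> u" using r u by (auto simp: R_def)
  \<comment> \<open>As an average of maps that are Lipschitz near 0, the nominal field is continuous
    there.\<close>
  have "F x = (1 / real m) *\<^sub>R (\<Sum>k=1..m. h k x)" for x unfolding sum_h using m by simp
  moreover have "continuous_on (cball 0 R) (\<lambda>x. (1 / real m) *\<^sub>R (\<Sum>k=1..m. h k x))"
    using R by (intro continuous_intros continuous_on_subset[OF lipschitz_on_continuous_on[OF lip]]) auto
  ultimately have contF: "continuous_on (cball 0 R) F" by (simp cong: continuous_on_cong)
  have "\<exists>z. caratheodory_solution (\<lambda>_. F) 0 x0 z" for x0
    using nominal_wp[of 0] by (simp add: well_posed_def F_def)
  then have neg: "B x x < 0" if "x \<noteq> 0" for x
    using lyapunov_form_negative[OF B(1,2) R(1) r(2) contF _ _ that] R(2) stable by (auto simp: F_def)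
  define P where "P x y = - B x y" for x y
  have P: "bounded_bilinear P"
  proof
    show "\<exists>K. \<forall>x y. norm (P x y) \<le> norm x * norm y * K"
      using B.bounded by (simp add: P_def)
  qed (simp_all add: P_def B.add_left B.add_right B.scaleR_left B.scaleR_right)
  have "P x x > 0" if "x \<noteq> 0" for x using neg[OF that] by (simp add: P_def)
  from positive_form_coercive[OF P this] obtain c where c: "c > 0" "\<And>x. c * (norm x)\<^sup>2 \<le> P x x" by blast
  obtain K where K: "K > 0" "\<And>x y. norm (P x y) \<le> norm x * norm y * K"
    using bounded_bilinear.pos_bounded[OF P] by blast
  interpret switched_family m h P R L K c
  proof (rule switched_family.intro)
    show "norm (h k x - h k y) \<le> L * norm (x - y)"
      if "k \<in> {1..m}" "norm x \<le> R" "norm y \<le> R" for k x y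
      using lipschitz_onD[OF lip[OF that(1)], of x y] that R by (simp add: dist_norm)
    \<comment> \<open>This is |x|^2 / 2 \<le> B x (F x), multiplied by 2 m and with the sign
      reversed.\<close>
    show "2 * P x (\<Sum>k=1..m. h k x) \<le> - real m * (norm x)\<^sup>2" if "norm x \<le> R" for x
      using mult_left_mono[OF r(2)[of x], of "2 * real m"] that R
      unfolding sum_h by (simp add: P_def B.scaleR_right)
  qed (use m R u K c P B(2) h0 in \<open>auto simp: P_def mult_ac\<close>)
  note uniform = exists_uniform_switching_time[OF G T]
  have "G \<tau> t0 t 0 = 0" if "switching_time T \<tau>" "t0 \<le> t" for \<tau> t0 t
    using that switch_index_int(2)[OF m, of \<tau> "t - t0"] by (simp add: G h0 switching_time_def)
  \<comment> \<open>Reflexivity lets \<tau>' itself serve as the switching time in the first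
    claim.\<close>
  moreover have "dominates \<tau> \<tau>" for \<tau> by (simp add: dominates_def)
  ultimately have "uniformly_asymptotically_stable T G"
    unfolding uniformly_asymptotically_stable_def using uniform by blast
  then show ?thesis using uniform unfolding G_def by blast
qed

end
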